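(* Let $\mathfrak{c}=\{c(\nu)\}_{\nu\ge1}$ be a sequence of nonnegative real numbers satisfying (c-1), (c-2), (c-3), let $\gamma(s)$ be a meromorphic function on $\mathbb{C}$ satisfying ($\gamma$-1), ($\gamma$-2), ($\gamma$-3), and let $\varepsilon\in\{\pm1\}$, $n\in\mathbb{Z}_{>0}$ (all notation and conditions as in the context). Suppose that there exists $x_0>0$ such that $Z^{\varepsilon,n}_{\mathfrak{c},\gamma}(x)$ has a single sign (does not change its sign) on $(0,x_0)$. Then there exists $\delta>0$ such that $\omega^{\varepsilon,n}_{\mathfrak{c},\gamma}(s)$ is continued holomorphically to the right half-plane $\Re(s)>n-\delta$ except for the pole $s=n$. Further suppose that $\omega^{\varepsilon,n}_{\mathfrak{c},\gamma}(s)$ is continued meromorphically to the right half-plane $\Re(s)>\sigma_0$ for some $\sigma_0<n$ without poles on the open real interval $(\sigma_0,n)$. Then $\omega^{\varepsilon,n}_{\mathfrak{c},\gamma}(s)$ has no pole in the vertical strip $\sigma_0<\Re(s)<n$.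
   Context: Put $D_{\mathfrak c}(s)=\sum_{\nu=1}^\infty c(\nu)\nu^{-s}$. The conditions on $\mathfrak{c}$ are: (c-1) for every fixed $\eta>0$ there is a constant $M_\eta>0$ with $0\le c(\nu)\le M_\eta\nu^{\eta}$ for all $\nu$; (c-2) there is a constant $\eta_{\mathfrak c}>0$ such that $D_{\mathfrak c}(s)$ is continued holomorphically to the region $\sigma\ge 1-\eta_{\mathfrak c}/\log(3+|t|)$ ($s=\sigma+it$) except for a pole of order $\lambda_{\mathfrak c}\ge1$ at $s=1$; (c-3) there are constants $M>0$, $A>0$ with $|D_{\mathfrak c}(\sigma+it)|\le M|t|^A$ whenever $\sigma\ge1$ and $|t|>1$. The conditions on $\gamma(s)$ are: ($\gamma$-1) $\gamma(s)$ is regular except for $s=1$; ($\gamma$-2) $\gamma(s)$ has a pole of order $\lambda_\gamma\ge1$ at $s=1$; ($\gamma$-3) for all real $a\le b$ and every real $A>0$, $|\gamma(\sigma+it)|\ll|t|^{-A}$ uniformly for $a\le\sigma\le b$, $|t|\ge t_0$. Let $\kappa_\gamma(x)=\frac1{2\pi i}\int_{\Re(s)=c}\gamma(s)x^{-s}\,ds$ ($c>1$) be the inverse Mellin transform of $\gamma$. For $x>0$ define $$V^{\varepsilon,n}_\gamma(x,\nu)=\kappa_\gamma(\nu x^{-n})-\varepsilon x^n\kappa_\gamma(\nu x^n),\qquad h^{\varepsilon,n}_{\mathfrak c,\gamma}(x)=\sum_{\nu=1}^\infty c(\nu)V^{\varepsilon,n}_\gamma(x,\nu),$$ $$\omega^{\varepsilon,n}_{\mathfrak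 c,\gamma}(s)=\int_0^1h^{\varepsilon,n}_{\mathfrak c,\gamma}(x)\,x^{s-n}\frac{dx}{x}\quad(\Re(s)>n),\qquad Z^{\varepsilon,n}_{\mathfrak c,\gamma}(x)=\Bigl(-x\frac{d}{dx}\Bigr)^{\lambda_{\mathfrak c}+\lambda_\gamma}h^{\varepsilon,n}_{\mathfrak c,\gamma}(x).$$ *)

theory Defs
  imports "HOL-Complex_Analysis.Complex_Analysis"
begin

definition has_pole_of_order :: "(complex \<Rightarrow> complex) \<Rightarrow> complex \<Rightarrow> nat \<Rightarrow> bool" where
  "has_pole_of_order f z k \<longleftrightarrow> is_pole f z \<and> zorder f z = - int k"

text \<open>
  Sequences are indexed by the positive integers; the value at \<open>0\<close> is never used.
\<close>

definition dirichlet_series :: "(nat \<Rightarrow> real) \<Rightarrow> complex \<Rightarrow> complex" where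
  "dirichlet_series c s = (\<Sum>\<nu>. of_real (c (Suc \<nu>)) * of_nat (Suc \<nu>) powr (- s))"

definition cond_c1 :: "(nat \<Rightarrow> real) \<Rightarrow> bool" where
  "cond_c1 c \<longleftrightarrow>
     (\<forall>\<eta>>0. \<exists>M>0. \<forall>\<nu>\<ge>1. 0 \<le> c \<nu> \<and> c \<nu> \<le> M * real \<nu> powr \<eta>)"

text \<open>
  \<open>D\<close> is the continuation of the Dirichlet series. The region is not open, so holomorphy
  on it is understood as holomorphy in a neighbourhood of each of its points.
\<close>

definition cond_c2 :: "(nat \<Rightarrow> real) \<Rightarrow> (complex \<Rightarrow> complex) \<Rightarrow> nat \<Rightarrow> bool" where
  "cond_c2 c D lam_c \<longleftrightarrow>
     (\<forall>s. Re s > 1 \<longrightarrow> D s = dirichlet_series c s) \<and>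
     (\<exists>\<eta>>0. D analytic_on ({s. Re s \<ge> 1 - \<eta> / ln (3 + \<bar>Im s\<bar>)} - {1})) \<and>
     lam_c \<ge> 1 \<and> has_pole_of_order D 1 lam_c"

definition cond_c3 :: "(complex \<Rightarrow> complex) \<Rightarrow> bool" where
  "cond_c3 D \<longleftrightarrow>
     (\<exists>M>0. \<exists>A>0. \<forall>\<sigma> t. \<sigma> \<ge> 1 \<and> \<bar>t\<bar> > 1 \<longrightarrow> norm (D (Complex \<sigma> t)) \<le> M * \<bar>t\<bar> powr A)"

definition cond_gamma1 :: "(complex \<Rightarrow> complex) \<Rightarrow> bool" where
  "cond_gamma1 \<gamma> \<longleftrightarrow> \<gamma> holomorphic_on (- {1})"

definition cond_gamma2 :: "(complex \<Rightarrow> complex) \<Rightarrow> nat \<Rightarrow> bool" where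
  "cond_gamma2 \<gamma> lam_\<gamma> \<longleftrightarrow> lam_\<gamma> \<ge> 1 \<and> has_pole_of_order \<gamma> 1 lam_\<gamma>"

definition cond_gamma3 :: "(complex \<Rightarrow> complex) \<Rightarrow> bool" where
  "cond_gamma3 \<gamma> \<longleftrightarrow>
     (\<forall>a b A. a \<le> b \<and> A > 0 \<longrightarrow>
       (\<exists>t\<^sub>0>0. \<exists>C. \<forall>\<sigma> t. a \<le> \<sigma> \<and> \<sigma> \<le> b \<and> \<bar>t\<bar> \<ge> t\<^sub>0 \<longrightarrow>
          norm (\<gamma> (Complex \<sigma> t)) \<le> C * \<bar>t\<bar> powr (- A)))"

text \<open>
  The inverse Mellin transform along the vertical line with real part \<open>a\<close>, parametrised
  as \<open>s = a + i t\<close>, so that \<open>ds = i dt\<close>.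
\<close>

definition kappa :: "(complex \<Rightarrow> complex) \<Rightarrow> real \<Rightarrow> real \<Rightarrow> complex" where
  "kappa \<gamma> a x =
     1 / (2 * of_real pi * \<i>) *
       (LINT t|lborel. \<gamma> (Complex a t) * of_real x powr (- Complex a t) * \<i>)"

definition V_fun ::
  "(complex \<Rightarrow> complex) \<Rightarrow> real \<Rightarrow> real \<Rightarrow> nat \<Rightarrow> real \<Rightarrow> nat \<Rightarrow> complex" where
  "V_fun \<gamma> a \<epsilon> n x \<nu> =
     kappa \<gamma> a (real \<nu> / x ^ n) - of_real (\<epsilon> * x ^ n) * kappa \<gamma> a (real \<nu> * x ^ n)"

definition h_fun ::
  "(nat \<Rightarrow> real) \<Rightarrow> (complex \<Rightarrow> complex) \<Rightarrow> real \<Rightarrow> real \<Rightarrow> nat \<Rightarrow> real \<Rightarrow> complex" where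
  "h_fun c \<gamma> a \<epsilon> n x = (\<Sum>\<nu>. of_real (c (Suc \<nu>)) * V_fun \<gamma> a \<epsilon> n x (Suc \<nu>))"

text \<open>Only meaningful for \<open>Re s > n\<close>.\<close>

definition omega_fun ::
  "(nat \<Rightarrow> real) \<Rightarrow> (complex \<Rightarrow> complex) \<Rightarrow> real \<Rightarrow> real \<Rightarrow> nat \<Rightarrow> complex \<Rightarrow> complex" where
  "omega_fun c \<gamma> a \<epsilon> n s =
     (LINT x:{0<..<1}|lborel. h_fun c \<gamma> a \<epsilon> n x * of_real x powr (s - of_nat n) / of_real x)"

definition neg_euler_op :: "(real \<Rightarrow> complex) \<Rightarrow> real \<Rightarrow> complex" where
  "neg_euler_op f x = (- x) *\<^sub>R vector_derivative f (at x)"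

definition Z_fun ::
  "(nat \<Rightarrow> real) \<Rightarrow> nat \<Rightarrow> (complex \<Rightarrow> complex) \<Rightarrow> nat \<Rightarrow> real \<Rightarrow> real \<Rightarrow> nat \<Rightarrow> real \<Rightarrow> complex" where
  "Z_fun c lam_c \<gamma> lam_\<gamma> a \<epsilon> n = (neg_euler_op ^^ (lam_c + lam_\<gamma>)) (h_fun c \<gamma> a \<epsilon> n)"

text \<open>Real-valued without change of sign; zeros are allowed.\<close>

definition single_sign_on :: "(real \<Rightarrow> complex) \<Rightarrow> real set \<Rightarrow> bool" where
  "single_sign_on f S \<longleftrightarrow>
     (\<forall>x\<in>S. f x \<in> \<real> \<and> Re (f x) \<ge> 0) \<or> (\<forall>x\<in>S. f x \<in> \<real> \<and> Re (f x) \<le> 0)"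

end

theory Submission
  imports Defs "HOL-Probability.Sinc_Integral" "HOL-Real_Asymp.Real_Asymp"
begin

text \<open>
Put \<open>G = \<gamma> D\<close> and \<open>k = lam_c + lam_\<gamma>\<close>. Summing the inverse Mellin transforms over \<open>\<nu>\<close> gives
\<open>h(x) = 1/(2\<pi>\<i>) \<integral> G(w) (x^{nw} - \<epsilon> x^{n-nw}) dw\<close> over any line \<open>Re w = a > 1\<close>
(\<open>h_fun_vertical_transform\<close>), and \<open>\<omega>(s)\<close> is the Mellin transform of \<open>h\<close> over \<open>(0,1)\<close> at
\<open>z = s - n\<close>. The exponents are affine in \<open>w\<close>, so \<open>- x d/dx\<close> multiplies the integrand by minus the
exponent; on the side of the Mellin transform it multiplies by \<open>z\<close>, up to a constant. Hence
\<open>(s - n)^k \<omega>(s)\<close> is the Mellin transform of \<open>Z\<close> plus a polynomial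
(\<open>mellin_euler_iterate_up_to_entire\<close>).

Near \<open>s = n\<close> the function \<open>\<omega>\<close> is understood explicitly: for \<open>n < Re s < na\<close>, moving the line
of integration across \<open>w = s/n\<close> shows that \<open>\<omega>(s)\<close> is \<open>- (\<epsilon>/n) G(s/n)\<close> plus a function that
is holomorphic near \<open>n\<close> (\<open>mellin_across_pole\<close>). Since \<open>G\<close> has a pole of order exactly \<open>k\<close> at
\<open>1\<close>, the product \<open>(s - n)^k \<omega>(s)\<close> extends holomorphically to a neighbourhood of \<open>n\<close> with
a nonzero value there, so the Mellin transform of \<open>Z\<close> extends past \<open>z = 0\<close>
(\<open>mellin_euler_iterate_continuation_at_0\<close>).

Now the sign of \<open>Z\<close> enters through Landau's principle: the Mellin transform of a function of one
sign near \<open>0\<close> has a singularity at the real point of its abscissa of convergence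
(\<open>Landau_laplace\<close>, \<open>Landau_mellin\<close>). The transform of \<open>Z\<close> is regular at \<open>0\<close>, so its abscissa is
negative; dividing by \<open>(s - n)^k\<close> gives the continuation of \<open>\<omega>\<close> to \<open>Re s > n - \<delta>\<close>. In the same
way, a meromorphic continuation of \<open>\<omega>\<close> without poles on the real interval \<open>(\<sigma>\<^sub>0, n)\<close> leaves no
place in that interval for the abscissa (shifted by \<open>n\<close>). The integral for \<open>Z\<close> then converges for
\<open>Re s > \<sigma>\<^sub>0\<close>, and the continuation can only have a pole at \<open>n\<close> (\<open>Landau_continuation\<close>).
\<close>

section \<open>Laplace transforms and Landau's theorem\<close>

text \<open>
Expand \<open>exp (l (s - s0))\<close> and integrate termwise. The partial sums are dominated by
\<open>exp (r \<bar>l\<bar>)\<close> with \<open>\<bar>s - s0\<bar> < r < Re s0 - \<sigma>\<^sub>1\<close>. Times \<open>exp (l Re s0)\<close> this is at most the sum of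
\<open>exp (l (Re s0 + r))\<close> and \<open>exp (l (Re s0 - r))\<close>, and both \<open>Re s0 \<plusminus> r\<close> lie in the range of
integrability. The resulting coefficients give holomorphy and are what Landau's argument needs.
\<close>

lemma laplace_power_series:
  fixes f :: "'a \<Rightarrow> complex" and l :: "'a \<Rightarrow> real"
  assumes [measurable]: "f \<in> borel_measurable M" "l \<in> borel_measurable M"
    and int: "\<And>\<sigma>. \<sigma> > \<sigma>\<^sub>1 \<Longrightarrow> integrable M (\<lambda>x. norm (f x) * exp (\<sigma> * l x))"
    and s: "norm (s - s0) < Re s0 - \<sigma>\<^sub>1"
  shows "integrable M (\<lambda>x. f x * exp (of_real (l x) * s0) * (of_real (l x) ^ m / fact m))"
    and "(\<lambda>m. (\<integral>x. f x * exp (of_real (l x) * s0) * (of_real (l x) ^ m / fact m) \<partial>M) * (s - s0) ^ m)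
           sums (\<integral>x. f x * exp (of_real (l x) * s) \<partial>M)"
proof -
  obtain r where r: "norm (s - s0) < r" "r < Re s0 - \<sigma>\<^sub>1"
    using dense[OF s] by auto
  have r0: "r > 0"
    using r(1) norm_ge_zero[of "s - s0"] by linarith
  define B where "B = (\<lambda>x. norm (f x) * exp ((Re s0 + r) * l x) + norm (f x) * exp ((Re s0 - r) * l x))"
  have intB: "integrable M B"
    unfolding B_def using r r0 by (intro Bochner_Integration.integrable_add int) auto
  have expB: "norm (f x) * exp (Re s0 * l x) * exp (r * \<bar>l x\<bar>) \<le> B x" for x
  proof -
    have "exp (Re s0 * l x) * exp (r * \<bar>l x\<bar>) \<le> exp ((Re s0 + r) * l x) + exp ((Re s0 - r) * l x)"
      by (cases "l x \<ge> 0") (auto simp: exp_add[symmetric] algebra_simps)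
    from mult_left_mono[OF this norm_ge_zero[of "f x"]] show ?thesis
      by (simp add: B_def algebra_simps)
  qed
  have part: "(\<Sum>m<N. t ^ m / fact m) \<le> exp t" if "t \<ge> 0" for t :: real and N
  proof -
    have "(\<lambda>m. t ^ m / fact m) sums exp t"
      using exp_converges[of t] by (simp add: field_simps)
    thus ?thesis
      using sum_le_suminf[of "\<lambda>m. t ^ m / fact m" "{..<N}"] that by (auto simp: sums_iff)
  qed
  have term_le: "t ^ m / fact m \<le> exp t" if "t \<ge> 0" for t :: real and m
  proof -
    have "t ^ m / fact m \<le> (\<Sum>j<Suc m. t ^ j / fact j)"
      using that by (simp add: sum_nonneg)
    thus ?thesis using part[OF that, of "Suc m"] by linarith
  qed
  show intm: "integrable M (\<lambda>x. f x * exp (of_real (l x) * s0) * (of_real (l x) ^ m / fact m))" for m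
  proof (rule Bochner_Integration.integrable_bound[OF integrable_mult_right[OF intB, of "1 / r ^ m"]])
    show "AE x in M. norm (f x * exp (of_real (l x) * s0) * (of_real (l x) ^ m / fact m)) \<le> norm (1 / r ^ m * B x)"
    proof (intro AE_I2)
      fix x
      have "norm (f x * exp (of_real (l x) * s0) * (of_real (l x) ^ m / fact m))
          = norm (f x) * exp (Re s0 * l x) * ((r * \<bar>l x\<bar>) ^ m / fact m) / r ^ m"
        using r0 by (simp add: norm_mult norm_divide norm_power field_simps)
      also have "\<dots> \<le> norm (f x) * exp (Re s0 * l x) * exp (r * \<bar>l x\<bar>) / r ^ m"
        using r0 by (intro divide_right_mono mult_left_mono term_le) auto
      also have "\<dots> \<le> B x / r ^ m"
        using r0 expB by (intro divide_right_mono) auto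
      also have "\<dots> \<le> norm (1 / r ^ m * B x)"
        using abs_ge_self[of "B x / r ^ m"] by simp
      finally show "norm (f x * exp (of_real (l x) * s0) * (of_real (l x) ^ m / fact m)) \<le> norm (1 / r ^ m * B x)" .
    qed
  qed simp
  let ?T = "\<lambda>N x. \<Sum>m<N. f x * exp (of_real (l x) * s0) * (of_real (l x) ^ m / fact m) * (s - s0) ^ m"
  have "(\<lambda>N. \<integral>x. ?T N x \<partial>M) \<longlonglongrightarrow> (\<integral>x. f x * exp (of_real (l x) * s) \<partial>M)"
  proof (rule integral_dominated_convergence[OF _ _ intB])
    show "AE x in M. (\<lambda>N. ?T N x) \<longlonglongrightarrow> f x * exp (of_real (l x) * s)"
    proof (intro AE_I2)
      fix x
      have "(\<lambda>m. (of_real (l x) * (s - s0)) ^ m /\<^sub>R fact m) sums exp (of_real (l x) * (s - s0))"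
        by (rule exp_converges)
      hence "(\<lambda>m. f x * exp (of_real (l x) * s0) * ((of_real (l x) * (s - s0)) ^ m /\<^sub>R fact m))
               sums (f x * exp (of_real (l x) * s0) * exp (of_real (l x) * (s - s0)))"
        by (rule sums_mult)
      also have "f x * exp (of_real (l x) * s0) * exp (of_real (l x) * (s - s0)) = f x * exp (of_real (l x) * s)"
        by (simp add: mult.assoc exp_add[symmetric] algebra_simps)
      also have "(\<lambda>m. f x * exp (of_real (l x) * s0) * ((of_real (l x) * (s - s0)) ^ m /\<^sub>R fact m))
          = (\<lambda>m. f x * exp (of_real (l x) * s0) * (of_real (l x) ^ m / fact m) * (s - s0) ^ m)"
        by (simp add: power_mult_distrib scaleR_conv_of_real divide_inverse mult_ac)
      finally show "(\<lambda>N. ?T N x) \<longlonglongrightarrow> f x * exp (of_real (l x) * s)"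
        unfolding sums_def .
    qed
    show "AE x in M. norm (?T N x) \<le> B x" for N
    proof (intro AE_I2)
      fix x
      have "norm (?T N x) \<le> (\<Sum>m<N. norm (f x) * exp (Re s0 * l x) * ((r * \<bar>l x\<bar>) ^ m / fact m))"
      proof (rule sum_norm_le)
        fix m
        have "(\<bar>l x\<bar> * norm (s - s0)) ^ m \<le> (r * \<bar>l x\<bar>) ^ m"
          using r r0 by (intro power_mono) (auto simp: mult.commute[of r] intro!: mult_left_mono)
        hence "norm (f x) * exp (Re s0 * l x) * ((\<bar>l x\<bar> * norm (s - s0)) ^ m / fact m)
             \<le> norm (f x) * exp (Re s0 * l x) * ((r * \<bar>l x\<bar>) ^ m / fact m)"
          by (intro mult_left_mono divide_right_mono) auto
        thus "norm (f x * exp (of_real (l x) * s0) * (of_real (l x) ^ m / fact m) * (s - s0) ^ m)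
             \<le> norm (f x) * exp (Re s0 * l x) * ((r * \<bar>l x\<bar>) ^ m / fact m)"
          by (simp add: norm_mult norm_divide norm_power power_mult_distrib mult_ac)
      qed
      also have "\<dots> = norm (f x) * exp (Re s0 * l x) * (\<Sum>m<N. (r * \<bar>l x\<bar>) ^ m / fact m)"
        by (simp only: sum_distrib_left)
      also have "\<dots> \<le> norm (f x) * exp (Re s0 * l x) * exp (r * \<bar>l x\<bar>)"
        using r0 by (intro mult_left_mono part) auto
      also have "\<dots> \<le> B x" by (rule expB)
      finally show "norm (?T N x) \<le> B x" .
    qed
  qed auto
  moreover have "(\<integral>x. ?T N x \<partial>M)
      = (\<Sum>m<N. (\<integral>x. f x * exp (of_real (l x) * s0) * (of_real (l x) ^ m / fact m) \<partial>M) * (s - s0) ^ m)" for N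
    by (subst Bochner_Integration.integral_sum)
       (intro integrable_mult_left intm, simp only: integral_mult_left_zero)
  ultimately show "(\<lambda>m. (\<integral>x. f x * exp (of_real (l x) * s0) * (of_real (l x) ^ m / fact m) \<partial>M) * (s - s0) ^ m)
           sums (\<integral>x. f x * exp (of_real (l x) * s) \<partial>M)"
    by (simp add: sums_def)
qed

lemma laplace_holomorphic:
  fixes f :: "'a \<Rightarrow> complex" and l :: "'a \<Rightarrow> real"
  assumes "f \<in> borel_measurable M" "l \<in> borel_measurable M"
    and "\<And>\<sigma>. \<sigma> > \<sigma>\<^sub>1 \<Longrightarrow> integrable M (\<lambda>x. norm (f x) * exp (\<sigma> * l x))"
  shows "(\<lambda>s. \<integral>x. f x * exp (of_real (l x) * s) \<partial>M) holomorphic_on {s. Re s > \<sigma>\<^sub>1}"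
proof -
  let ?L = "\<lambda>s. \<integral>x. f x * exp (of_real (l x) * s) \<partial>M"
  have "?L field_differentiable at s0" if "Re s0 > \<sigma>\<^sub>1" for s0
  proof -
    have "?L holomorphic_on ball s0 (Re s0 - \<sigma>\<^sub>1)"
      by (rule power_series_holomorphic, rule laplace_power_series(2)[OF assms])
         (auto simp: dist_norm norm_minus_commute)
    thus ?thesis
      using that by (simp add: holomorphic_on_imp_differentiable_at)
  qed
  thus ?thesis
    by (auto simp: holomorphic_on_def intro: field_differentiable_at_within)
qed

text \<open>
Landau's theorem in contrapositive form: if the transform of a nonnegative \<open>p\<close> extends
holomorphically around the real point \<open>\<sigma>\<^sub>1\<close>, then the integral converges to the left of \<open>\<sigma>\<^sub>1\<close>.
Expand the continuation \<open>g\<close> around \<open>s0 = \<sigma>\<^sub>1 + \<rho>/4\<close>. Its Taylor series converges on a disc that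
contains \<open>s0 - \<rho>/3 < \<sigma>\<^sub>1\<close>, and by \<open>laplace_power_series\<close> its terms at this point are the
integrals of the terms of \<open>p exp (s0 l) exp (- (\<rho>/3) l)\<close>. Since \<open>l \<le> 0\<close> where \<open>p\<close> does not
vanish, all these terms are nonnegative, so convergence of the series of integrals is integrability
of the sum.
\<close>

lemma Landau_laplace:
  fixes p l :: "'a \<Rightarrow> real" and g :: "complex \<Rightarrow> complex"
  assumes [measurable]: "p \<in> borel_measurable M" "l \<in> borel_measurable M"
    and p: "\<And>x. p x \<ge> 0" and l: "\<And>x. p x \<noteq> 0 \<Longrightarrow> l x \<le> 0"
    and int: "\<And>\<sigma>. \<sigma> > \<sigma>\<^sub>1 \<Longrightarrow> integrable M (\<lambda>x. p x * exp (\<sigma> * l x))"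
    and \<rho>: "\<rho> > 0" and g: "g holomorphic_on ball (of_real \<sigma>\<^sub>1) \<rho>"
    and eq: "\<And>s. s \<in> ball (of_real \<sigma>\<^sub>1) \<rho> \<Longrightarrow> Re s > \<sigma>\<^sub>1 \<Longrightarrow>
               g s = (\<integral>x. of_real (p x) * exp (of_real (l x) * s) \<partial>M)"
  shows "\<exists>\<sigma><\<sigma>\<^sub>1. integrable M (\<lambda>x. p x * exp (\<sigma> * l x))"
proof -
  define \<sigma>\<^sub>0 where "\<sigma>\<^sub>0 = \<sigma>\<^sub>1 + \<rho> / 4"
  define s0 :: complex where "s0 = of_real \<sigma>\<^sub>0"
  have d: "dist (of_real \<sigma>\<^sub>1) s0 = \<rho> / 4"
    using \<rho> by (simp add: s0_def \<sigma>\<^sub>0_def dist_norm)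
  have sub: "ball s0 (\<rho> / 2) \<subseteq> ball (of_real \<sigma>\<^sub>1) \<rho>"
  proof
    fix s assume "s \<in> ball s0 (\<rho> / 2)"
    thus "s \<in> ball (of_real \<sigma>\<^sub>1) \<rho>"
      using dist_triangle[of "of_real \<sigma>\<^sub>1" s s0] d \<rho> by simp
  qed
  have int': "integrable M (\<lambda>x. norm (complex_of_real (p x)) * exp (\<sigma> * l x))" if "\<sigma> > \<sigma>\<^sub>1" for \<sigma>
    using int[OF that] p by (simp add: norm_of_real abs_of_nonneg)
  define b where "b m = (\<integral>x. p x * exp (\<sigma>\<^sub>0 * l x) * (l x ^ m / fact m) \<partial>M)" for m
  have conv: "of_real (p x) * exp (of_real (l x) * s0) * (of_real (l x) ^ m / fact m)
      = complex_of_real (p x * exp (\<sigma>\<^sub>0 * l x) * (l x ^ m / fact m))" for x m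
    by (simp add: s0_def mult.commute flip: exp_of_real)
  have b_eq: "(\<integral>x. of_real (p x) * exp (of_real (l x) * s0) * (of_real (l x) ^ m / fact m) \<partial>M) = of_real (b m)" for m
    unfolding conv b_def by (rule integral_complex_of_real)
  have intb: "integrable M (\<lambda>x. p x * exp (\<sigma>\<^sub>0 * l x) * (l x ^ m / fact m))" for m
  proof -
    have "integrable M (\<lambda>x. complex_of_real (p x) * exp (of_real (l x) * s0) * (of_real (l x) ^ m / fact m))"
      by (rule laplace_power_series(1)[where \<sigma>\<^sub>1 = \<sigma>\<^sub>1 and s = s0]) (use \<rho> int' in \<open>auto simp: s0_def \<sigma>\<^sub>0_def\<close>)
    hence "integrable M (\<lambda>x. norm (complex_of_real (p x) * exp (of_real (l x) * s0) * (of_real (l x) ^ m / fact m)))"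
      by (rule integrable_norm)
    hence "integrable M (\<lambda>x. \<bar>p x * exp (\<sigma>\<^sub>0 * l x) * (l x ^ m / fact m)\<bar>)"
      unfolding conv norm_of_real .
    thus ?thesis
      by (subst (asm) integrable_abs_iff) auto
  qed
  have ser: "(\<lambda>m. of_real (b m) * u ^ m) sums g (s0 + u)" if u: "norm u < \<rho> / 4" for u
  proof -
    have "s0 + u \<in> ball s0 (\<rho> / 2)" using u \<rho> by (simp add: dist_norm)
    with sub have "s0 + u \<in> ball (of_real \<sigma>\<^sub>1) \<rho>" by blast
    moreover have "Re (s0 + u) > \<sigma>\<^sub>1"
      using abs_Re_le_cmod[of u] u by (simp add: s0_def \<sigma>\<^sub>0_def)
    ultimately have "g (s0 + u) = (\<integral>x. of_real (p x) * exp (of_real (l x) * (s0 + u)) \<partial>M)"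
      by (rule eq)
    moreover have "(\<lambda>m. of_real (b m) * (s0 + u - s0) ^ m) sums (\<integral>x. of_real (p x) * exp (of_real (l x) * (s0 + u)) \<partial>M)"
      unfolding b_eq[symmetric]
      by (rule laplace_power_series(2)[where \<sigma>\<^sub>1 = \<sigma>\<^sub>1]) (use u int' in \<open>auto simp: s0_def \<sigma>\<^sub>0_def\<close>)
    ultimately show ?thesis by simp
  qed
  have "(\<lambda>u. g (s0 + u)) has_fps_expansion Abs_fps (\<lambda>m. of_real (b m))"
  proof (rule has_fps_expansionI)
    have "eventually (\<lambda>u::complex. u \<in> ball 0 (\<rho> / 4)) (nhds 0)"
      using \<rho> by (intro eventually_nhds_in_open) auto
    thus "\<forall>\<^sub>F u in nhds 0. (\<lambda>m. fps_nth (Abs_fps (\<lambda>m. of_real (b m))) m * u ^ m) sums g (s0 + u)"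
      by eventually_elim (use ser in auto)
  qed
  hence coeff: "complex_of_real (b m) = (deriv ^^ m) (\<lambda>u. g (s0 + u)) 0 / fact m" for m
    by (drule_tac fps_nth_fps_expansion[where n = m]) simp
  have "(\<lambda>u. g (s0 + u)) holomorphic_on ball 0 (\<rho> / 2)"
  proof (rule holomorphic_on_compose_gen[of "\<lambda>u. s0 + u" _ g, unfolded o_def])
    show "g holomorphic_on ball (of_real \<sigma>\<^sub>1) \<rho>" by (rule g)
    show "(+) s0 ` ball 0 (\<rho> / 2) \<subseteq> ball (of_real \<sigma>\<^sub>1) \<rho>"
      using sub by auto
  qed (auto intro!: holomorphic_intros)
  hence "(\<lambda>m. (deriv ^^ m) (\<lambda>u. g (s0 + u)) 0 / fact m * (- of_real (\<rho> / 3) - 0) ^ m)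
           sums g (s0 + (- of_real (\<rho> / 3)))"
    by (rule holomorphic_power_series) (use \<rho> in auto)
  hence "summable (\<lambda>m. complex_of_real (b m) * (- of_real (\<rho> / 3)) ^ m)"
    unfolding coeff by (simp add: sums_iff)
  hence "summable (\<lambda>m. complex_of_real (b m * (- (\<rho> / 3)) ^ m))"
    by simp
  hence summ: "summable (\<lambda>m. b m * (- (\<rho> / 3)) ^ m)"
    by (simp only: summable_of_real_iff)
  define F where "F m x = p x * exp (\<sigma>\<^sub>0 * l x) * ((- (\<rho> / 3) * l x) ^ m / fact m)" for m x
  have F_alt: "F m x = p x * exp (\<sigma>\<^sub>0 * l x) * (l x ^ m / fact m) * (- (\<rho> / 3)) ^ m" for m x
    by (simp add: F_def power_mult_distrib[symmetric] mult_ac)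
  have F0: "F m x \<ge> 0" for m x
  proof (cases "p x = 0")
    case False
    with l[of x] have "- (\<rho> / 3) * l x \<ge> 0"
      using \<rho> by (intro mult_nonpos_nonpos) auto
    hence "(- (\<rho> / 3) * l x) ^ m \<ge> 0"
      by (rule zero_le_power)
    with p[of x] show ?thesis
      unfolding F_def by (intro mult_nonneg_nonneg divide_nonneg_nonneg) auto
  qed (simp add: F_def)
  have Fsums: "(\<lambda>m. F m x) sums (p x * exp ((\<sigma>\<^sub>0 - \<rho> / 3) * l x))" for x
  proof -
    have "(\<lambda>m. (- (\<rho> / 3) * l x) ^ m / fact m) sums exp (- (\<rho> / 3) * l x)"
      using exp_converges[of "- (\<rho> / 3) * l x"] by (simp only: real_scaleR_def divide_inverse mult.commute)
    from sums_mult[OF this, of "p x * exp (\<sigma>\<^sub>0 * l x)"]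
    have "(\<lambda>m. F m x) sums (p x * exp (\<sigma>\<^sub>0 * l x) * exp (- (\<rho> / 3) * l x))"
      by (simp add: F_def)
    also have "p x * exp (\<sigma>\<^sub>0 * l x) * exp (- (\<rho> / 3) * l x) = p x * exp ((\<sigma>\<^sub>0 - \<rho> / 3) * l x)"
      by (simp add: mult.assoc exp_add[symmetric] algebra_simps)
    finally show ?thesis .
  qed
  have intF: "integrable M (F m)" for m
    unfolding F_alt[abs_def] by (intro integrable_mult_left intb)
  have "integrable M (\<lambda>x. \<Sum>m. F m x)"
  proof (rule integrable_suminf[OF intF])
    show "AE x in M. summable (\<lambda>m. norm (F m x))"
      using Fsums F0 by (intro AE_I2) (auto simp: sums_iff abs_of_nonneg)
    have "(\<integral>x. norm (F m x) \<partial>M) = b m * (- (\<rho> / 3)) ^ m" for m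
    proof -
      have "(\<integral>x. norm (F m x) \<partial>M) = (\<integral>x. F m x \<partial>M)"
        using F0 by (simp add: abs_of_nonneg)
      also have "\<dots> = b m * (- (\<rho> / 3)) ^ m"
        unfolding F_alt b_def by simp
      finally show ?thesis .
    qed
    with summ show "summable (\<lambda>m. \<integral>x. norm (F m x) \<partial>M)"
      by simp
  qed
  also have "(\<lambda>x. \<Sum>m. F m x) = (\<lambda>x. p x * exp ((\<sigma>\<^sub>0 - \<rho> / 3) * l x))"
    using Fsums by (auto simp: sums_iff)
  finally show ?thesis
    using \<rho> by (intro exI[of _ "\<sigma>\<^sub>0 - \<rho> / 3"]) (auto simp: \<sigma>\<^sub>0_def)
qed

section \<open>Mellin transforms over the unit interval\<close>

text \<open>
The Mellin transform is taken over \<open>(0,1)\<close> only and is written as a Laplace transform in \<open>ln x\<close>;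
the factor \<open>1/x\<close> of the measure \<open>dx/x\<close> is part of the density.
\<close>

definition mellin_density :: "(real \<Rightarrow> complex) \<Rightarrow> real \<Rightarrow> complex" where
  "mellin_density f x = indicator {0<..<1} x *\<^sub>R (f x / of_real x)"

definition mellin :: "(real \<Rightarrow> complex) \<Rightarrow> complex \<Rightarrow> complex" where
  "mellin f z = (LINT x|lborel. mellin_density f x * exp (of_real (ln x) * z))"

definition mellin_integrable :: "(real \<Rightarrow> complex) \<Rightarrow> complex \<Rightarrow> bool" where
  "mellin_integrable f z \<longleftrightarrow> integrable lborel (\<lambda>x. mellin_density f x * exp (of_real (ln x) * z))"

lemma norm_mellin_integrand:
  "norm (mellin_density f x * exp (of_real (ln x) * z)) = norm (mellin_density f x) * exp (Re z * ln x)"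
  by (simp add: norm_mult mult.commute)

lemma mellin_density_measurable:
  assumes "mellin_integrable f z"
  shows "mellin_density f \<in> borel_measurable lborel"
proof -
  have [measurable]: "(\<lambda>x. mellin_density f x * exp (of_real (ln x) * z)) \<in> borel_measurable lborel"
    using assms unfolding mellin_integrable_def by (rule borel_measurable_integrable)
  have "(\<lambda>x. mellin_density f x * exp (of_real (ln x) * z) * exp (of_real (ln x) * - z)) \<in> borel_measurable lborel"
    by measurable
  thus ?thesis by (simp add: mult.assoc exp_add[symmetric])
qed

lemma mellin_integrable_iff_norm:
  assumes "mellin_density f \<in> borel_measurable lborel"
  shows "mellin_integrable f z \<longleftrightarrow> integrable lborel (\<lambda>x. norm (mellin_density f x) * exp (Re z * ln x))"
  unfolding mellin_integrable_def norm_mellin_integrand[symmetric]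
  using assms by (subst integrable_norm_iff) auto

lemma mellin_integrable_mono:
  assumes f: "mellin_integrable f z0" and z: "Re z0 \<le> Re z"
  shows "mellin_integrable f z"
proof -
  note [measurable] = mellin_density_measurable[OF f]
  have "integrable lborel (\<lambda>x. norm (mellin_density f x) * exp (Re z0 * ln x))"
    using f mellin_integrable_iff_norm[OF mellin_density_measurable[OF f]] by blast
  hence "integrable lborel (\<lambda>x. norm (mellin_density f x) * exp (Re z * ln x))"
  proof (rule Bochner_Integration.integrable_bound)
    show "AE x in lborel. norm (norm (mellin_density f x) * exp (Re z * ln x))
        \<le> norm (norm (mellin_density f x) * exp (Re z0 * ln x))"
      using z by (auto simp: mellin_density_def indicator_def mult_right_mono_neg intro!: AE_I2 divide_right_mono mult_left_mono)
  qed measurable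
  thus ?thesis
    using mellin_integrable_iff_norm[OF mellin_density_measurable[OF f]] by blast
qed

lemma mellin_holomorphic:
  assumes "\<And>\<sigma>. \<sigma> > \<sigma>\<^sub>1 \<Longrightarrow> mellin_integrable f (of_real \<sigma>)"
  shows "mellin f holomorphic_on {z. Re z > \<sigma>\<^sub>1}"
proof -
  have m: "mellin_density f \<in> borel_measurable lborel"
    by (rule mellin_density_measurable, rule assms[of "\<sigma>\<^sub>1 + 1"]) simp
  have "(\<lambda>z. LINT x|lborel. mellin_density f x * exp (of_real (ln x) * z)) holomorphic_on {z. Re z > \<sigma>\<^sub>1}"
  proof (rule laplace_holomorphic[OF m])
    show "integrable lborel (\<lambda>x. norm (mellin_density f x) * exp (\<sigma> * ln x))" if "\<sigma> > \<sigma>\<^sub>1" for \<sigma>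
      using assms[OF that] mellin_integrable_iff_norm[OF m, of "of_real \<sigma>"] by simp
  qed simp
  thus ?thesis by (simp add: mellin_def[abs_def])
qed

lemma mellin_cong:
  assumes "\<And>x. 0 < x \<Longrightarrow> x < 1 \<Longrightarrow> f x = g x"
  shows "mellin f = mellin g" "mellin_integrable f = mellin_integrable g"
proof -
  have "mellin_density f = mellin_density g"
    using assms by (auto simp: mellin_density_def indicator_def fun_eq_iff)
  thus "mellin f = mellin g" "mellin_integrable f = mellin_integrable g"
    by (simp_all add: mellin_def[abs_def] mellin_integrable_def[abs_def])
qed

lemma
  assumes f: "mellin_integrable f z" and g: "mellin_integrable g z"
  shows mellin_integrable_diff: "mellin_integrable (\<lambda>x. f x - c * g x) z"
    and mellin_diff: "mellin (\<lambda>x. f x - c * g x) z = mellin f z - c * mellin g z"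
proof -
  have eq: "mellin_density (\<lambda>x. f x - c * g x) x * exp (of_real (ln x) * z)
     = mellin_density f x * exp (of_real (ln x) * z) - c * (mellin_density g x * exp (of_real (ln x) * z))" for x
    by (simp add: mellin_density_def algebra_simps diff_divide_distrib)
  show "mellin_integrable (\<lambda>x. f x - c * g x) z"
    using f g unfolding mellin_integrable_def eq by (intro Bochner_Integration.integrable_diff integrable_mult_right)
  show "mellin (\<lambda>x. f x - c * g x) z = mellin f z - c * mellin g z"
    using f g unfolding mellin_integrable_def mellin_def eq
    by (subst Bochner_Integration.integral_diff) (auto intro: integrable_mult_right)
qed

section \<open>Superpositions of powers\<close>

text \<open>
With \<open>g\<close> and \<open>\<phi>\<close> the values of an integrand and an exponent along a vertical line, this is the
superposition \<open>1/(2\<pi>) \<integral> g(t) x^{\<phi>(t)} dt\<close>, for \<open>x > 0\<close>.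
\<close>

definition line_integral :: "(real \<Rightarrow> complex) \<Rightarrow> (real \<Rightarrow> complex) \<Rightarrow> real \<Rightarrow> complex" where
  "line_integral g \<phi> x = 1 / (2 * of_real pi) * (LINT t|lborel. g t * exp (\<phi> t * of_real (ln x)))"

lemma integrable_mult_exp_line:
  assumes g: "integrable lborel g" and [measurable]: "\<phi> \<in> borel_measurable lborel" and \<phi>: "\<And>t. Re (\<phi> t) = \<rho>"
  shows "integrable lborel (\<lambda>t. g t * exp (\<phi> t * of_real u) :: complex)"
proof (rule Bochner_Integration.integrable_bound[OF integrable_mult_right[OF g, of "of_real (exp (\<rho> * u))"]])
  have [measurable]: "g \<in> borel_measurable lborel" using g by auto
  show "(\<lambda>t. g t * exp (\<phi> t * of_real u)) \<in> borel_measurable lborel"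
    by measurable
qed (simp add: norm_mult \<phi>)

text \<open>
In the variable \<open>u = ln x\<close> the integrand is \<open>g exp (\<phi> u)\<close>. Taylor's formula bounds the error of
its linearisation at \<open>u\<close> by a multiple of \<open>\<bar>g \<phi>\<^sup>2\<bar> d\<^sup>2\<close>, uniformly in \<open>\<bar>d\<bar> < 1\<close> because \<open>Re \<phi>\<close> is
constant; so one may differentiate under the integral.
\<close>

lemma line_integral_has_vector_derivative:
  assumes g: "integrable lborel g" and g1: "integrable lborel (\<lambda>t. g t * \<phi> t)"
    and g2: "integrable lborel (\<lambda>t. g t * \<phi> t ^ 2)"
    and m: "\<phi> \<in> borel_measurable lborel" and \<phi>: "\<And>t. Re (\<phi> t) = \<rho>" and x: "x > 0"
  shows "(line_integral g \<phi> has_vector_derivative (1 / x) *\<^sub>R line_integral (\<lambda>t. g t * \<phi> t) \<phi> x) (at x)"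
proof -
  define E where "E h u = (LINT t|lborel. h t * exp (\<phi> t * of_real u))" for h and u :: real
  note i0 = integrable_mult_exp_line[OF g m \<phi>] and i1 = integrable_mult_exp_line[OF g1 m \<phi>]
  have ig2: "integrable lborel (\<lambda>t. norm (g t * \<phi> t ^ 2))"
    using g2 by simp
  have DE: "(E g has_vector_derivative E (\<lambda>t. g t * \<phi> t) u) (at u)" for u
    unfolding has_vector_derivative_def
  proof (rule has_derivativeI_sandwich[where e = 1])
    let ?C = "(LINT t|lborel. norm (g t * \<phi> t ^ 2)) * (exp (\<rho> * u) * exp \<bar>\<rho>\<bar>)"
    fix y assume y: "y \<noteq> u" "dist y u < 1"
    define d where "d = y - u"
    have y_eq: "y = u + d" by (simp add: d_def)
    have d: "d \<noteq> 0" "\<bar>d\<bar> < 1"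
      using y by (auto simp: d_def dist_real_def)
    have eq: "E g y - E g u - (y - u) *\<^sub>R E (\<lambda>t. g t * \<phi> t) u
        = (LINT t|lborel. g t * exp (\<phi> t * of_real y) - g t * exp (\<phi> t * of_real u) - d *\<^sub>R (g t * \<phi> t * exp (\<phi> t * of_real u)))"
      unfolding E_def d_def using i0 i1 by simp
    have le: "norm (LINT t|lborel. g t * exp (\<phi> t * of_real y) - g t * exp (\<phi> t * of_real u) - d *\<^sub>R (g t * \<phi> t * exp (\<phi> t * of_real u)))
        \<le> (LINT t|lborel. norm (g t * \<phi> t ^ 2) * (exp (\<rho> * u) * exp \<bar>\<rho>\<bar> * d\<^sup>2))"
    proof (rule Bochner_Integration.integral_norm_bound_integral)
      fix t
      have "norm (exp (\<phi> t * of_real d) - (\<Sum>k\<le>1. (\<phi> t * of_real d) ^ k / fact k)) \<le> exp \<bar>Re (\<phi> t * of_real d)\<bar> * norm (\<phi> t * of_real d) ^ Suc 1 / fact 1"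
        by (rule Taylor_exp)
      hence "norm (exp (\<phi> t * of_real d) - 1 - \<phi> t * of_real d) \<le> exp \<bar>Re (\<phi> t * of_real d)\<bar> * norm (\<phi> t * of_real d) ^ 2"
        by (simp add: algebra_simps power2_eq_square)
      also have "exp \<bar>Re (\<phi> t * of_real d)\<bar> * norm (\<phi> t * of_real d) ^ 2
            = exp (\<bar>\<rho>\<bar> * \<bar>d\<bar>) * (norm (\<phi> t ^ 2) * d\<^sup>2)"
        by (simp add: \<phi> abs_mult norm_mult norm_power power2_eq_square mult_ac)
      also have "\<dots> \<le> exp \<bar>\<rho>\<bar> * (norm (\<phi> t ^ 2) * d\<^sup>2)"
        using d mult_left_mono[of "\<bar>d\<bar>" 1 "\<bar>\<rho>\<bar>"] by (intro mult_right_mono) auto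
      finally have T: "norm (exp (\<phi> t * of_real d) - 1 - \<phi> t * of_real d) \<le> exp \<bar>\<rho>\<bar> * (norm (\<phi> t ^ 2) * d\<^sup>2)" .
      have "g t * exp (\<phi> t * of_real y) - g t * exp (\<phi> t * of_real u) - d *\<^sub>R (g t * \<phi> t * exp (\<phi> t * of_real u))
          = g t * exp (\<phi> t * of_real u) * (exp (\<phi> t * of_real d) - 1 - \<phi> t * of_real d)"
        by (simp add: y_eq exp_add scaleR_conv_of_real algebra_simps)
      also have "norm \<dots> \<le> norm (g t) * exp (\<rho> * u) * (exp \<bar>\<rho>\<bar> * (norm (\<phi> t ^ 2) * d\<^sup>2))"
        using T by (simp add: norm_mult \<phi> mult_left_mono)
      finally show "norm (g t * exp (\<phi> t * of_real y) - g t * exp (\<phi> t * of_real u) - d *\<^sub>R (g t * \<phi> t * exp (\<phi> t * of_real u)))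
          \<le> norm (g t * \<phi> t ^ 2) * (exp (\<rho> * u) * exp \<bar>\<rho>\<bar> * d\<^sup>2)"
        by (simp add: norm_mult mult_ac)
    qed (use i0 i1 ig2 in \<open>auto intro!: integrable_mult_left\<close>)
    have val: "(LINT t|lborel. norm (g t * \<phi> t ^ 2) * (exp (\<rho> * u) * exp \<bar>\<rho>\<bar> * d\<^sup>2)) = ?C * d\<^sup>2"
      by simp
    have "norm (E g y - E g u - (y - u) *\<^sub>R E (\<lambda>t. g t * \<phi> t) u) \<le> ?C * d\<^sup>2"
      using le unfolding eq val .
    hence "norm (E g y - E g u - (y - u) *\<^sub>R E (\<lambda>t. g t * \<phi> t) u) / norm (y - u) \<le> ?C * d\<^sup>2 / norm (y - u)"
      by (rule divide_right_mono) simp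
    also have "\<dots> = ?C * \<bar>y - u\<bar>"
      using d by (simp add: d_def power2_eq_square abs_if field_simps)
    finally show "norm (E g y - E g u - (y - u) *\<^sub>R E (\<lambda>t. g t * \<phi> t) u) / norm (y - u) \<le> ?C * \<bar>y - u\<bar>" .
  next
    show "((\<lambda>y. (LINT t|lborel. norm (g t * \<phi> t ^ 2)) * (exp (\<rho> * u) * exp \<bar>\<rho>\<bar>) * \<bar>y - u\<bar>) \<longlongrightarrow> 0) (at u)"
      by (rule tendsto_eq_intros refl)+ simp
  qed (auto intro: bounded_linear_scaleR_left)
  have "(E g \<circ> ln has_vector_derivative (1 / x) *\<^sub>R E (\<lambda>t. g t * \<phi> t) (ln x)) (at x)"
    by (rule vector_diff_chain_at)
       (use x DE in \<open>auto intro!: derivative_eq_intros simp: has_real_derivative_iff_has_vector_derivative[symmetric] divide_inverse\<close>)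
  hence "((\<lambda>x. 1 / (2 * of_real pi) * (E g \<circ> ln) x) has_vector_derivative
            1 / (2 * of_real pi) * ((1 / x) *\<^sub>R E (\<lambda>t. g t * \<phi> t) (ln x))) (at x)"
    by (rule has_vector_derivative_mult_right)
  thus ?thesis
    by (simp add: E_def line_integral_def[abs_def] o_def)
qed

lemma
  fixes z :: complex
  assumes z: "Re z > 0"
  shows mellin_unit_interval_integrable: "set_integrable lborel {0<..<1} (\<lambda>x. exp (z * of_real (ln x)) / of_real x)"
    and mellin_unit_interval: "(LINT x:{0<..<1}|lborel. exp (z * of_real (ln x)) / of_real x) = 1 / z"
proof -
  have ein: "einterval 0 1 = {0<..<1::real}"
    using einterval_eq_Icc[of 0 1] by (simp add: zero_ereal_def one_ereal_def)
  have F: "((\<lambda>x. exp (z * of_real (ln x)) / z) has_vector_derivative exp (z * of_real (ln x)) / of_real x) (at x)"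
    if "x > 0" for x :: real
  proof -
    have 1: "((\<lambda>x. complex_of_real (ln x)) has_vector_derivative of_real (1 / x)) (at x)"
      using that by (intro has_vector_derivative_of_real)
        (auto intro!: derivative_eq_intros simp: has_real_derivative_iff_has_vector_derivative[symmetric] divide_inverse)
    have 2: "((\<lambda>w. exp (z * w) / z) has_field_derivative exp (z * of_real (ln x))) (at (of_real (ln x)))"
      using z by (auto intro!: derivative_eq_intros)
    show ?thesis
      using field_vector_diff_chain_at[OF 1 2] by (simp add: o_def)
  qed
  have lim0: "((\<lambda>x. exp (z * of_real (ln x)) / z) \<longlongrightarrow> 0) (at_right 0)"
  proof (rule tendsto_norm_zero_cancel)
    have "((\<lambda>x. exp (Re z * ln x)) \<longlongrightarrow> 0) (at_right 0)"
      using z by real_asymp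
    from tendsto_divide_zero[OF this, of "norm z"]
    have "((\<lambda>x. exp (Re z * ln x) / norm z) \<longlongrightarrow> 0) (at_right 0)" .
    thus "((\<lambda>x. norm (exp (z * of_real (ln x)) / z)) \<longlongrightarrow> 0) (at_right 0)"
      by (simp add: norm_divide)
  qed
  have lim1: "((\<lambda>x. exp (z * of_real (ln x)) / z) \<longlongrightarrow> 1 / z) (at_left 1)"
    using z by (auto intro!: tendsto_eq_intros)
  let ?\<sigma> = "Re z"
  have "set_integrable lborel (einterval 0 1) (\<lambda>x. exp (?\<sigma> * ln x) / x)"
  proof (rule interval_integral_FTC_nonneg[where F = "\<lambda>x. exp (?\<sigma> * ln x) / ?\<sigma>" and A = 0 and B = "1 / ?\<sigma>"])
    show "(((\<lambda>x. exp (?\<sigma> * ln x) / ?\<sigma>) \<circ> real_of_ereal) \<longlongrightarrow> 0) (at_right 0)"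
      using z unfolding zero_ereal_def one_ereal_def ereal_tendsto_simps by real_asymp
    show "(((\<lambda>x. exp (?\<sigma> * ln x) / ?\<sigma>) \<circ> real_of_ereal) \<longlongrightarrow> 1 / ?\<sigma>) (at_left 1)"
      using z unfolding zero_ereal_def one_ereal_def ereal_tendsto_simps by (auto intro!: tendsto_eq_intros)
  qed (use z in \<open>auto intro!: derivative_eq_intros continuous_intros AE_I2 simp: field_simps\<close>)
  hence int: "set_integrable lborel {0<..<1} (\<lambda>x. exp (?\<sigma> * ln x) / x)"
    by (simp only: ein)
  show i: "set_integrable lborel {0<..<1} (\<lambda>x. exp (z * of_real (ln x)) / of_real x)"
    by (rule set_integrable_bound[OF int]) (auto simp: norm_divide set_borel_measurable_def)
  have "(LBINT x=0..1. exp (z * of_real (ln x)) / of_real x) = 1 / z - 0"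
  proof (rule interval_integral_FTC_integrable[where F = "\<lambda>x. exp (z * of_real (ln x)) / z"])
    show "((\<lambda>x. exp (z * of_real (ln x)) / z) has_vector_derivative exp (z * of_real (ln x)) / of_real x) (at x)"
      if "0 < ereal x" for x using F[of x] that by simp
    show "set_integrable lborel (einterval 0 1) (\<lambda>x. exp (z * of_real (ln x)) / of_real x)"
      using i by (simp only: ein)
  qed (use z lim0 lim1 in \<open>auto intro!: continuous_intros simp: ereal_tendsto_simps zero_ereal_def one_ereal_def\<close>)
  thus "(LINT x:{0<..<1}|lborel. exp (z * of_real (ln x)) / of_real x) = 1 / z"
    using ein by (simp add: interval_lebesgue_integral_def)
qed

text \<open>
Fubini's theorem and \<open>\<integral>\<^sub>0\<^sup>1 x^{s+\<phi>} dx/x = 1/(s+\<phi>)\<close>; absolute integrability in both variables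
needs only \<open>Re s + \<rho> > 0\<close>.
\<close>

lemma
  assumes g: "integrable lborel g" and m[measurable]: "\<phi> \<in> borel_measurable lborel"
    and \<phi>: "\<And>t. Re (\<phi> t) = \<rho>" and s: "Re s > - \<rho>"
  shows line_integral_mellin_integrable: "mellin_integrable (line_integral g \<phi>) s"
    and line_integral_mellin:
      "mellin (line_integral g \<phi>) s = 1 / (2 * of_real pi) * (LINT t|lborel. g t / (s + \<phi> t))"
proof -
  have [measurable]: "g \<in> borel_measurable lborel" using g by auto
  define f where "f x t = indicator {0<..<1} x *\<^sub>R (g t * (exp ((s + \<phi> t) * of_real (ln x)) / of_real x))" for x t :: real
  have f_alt: "f x t = indicator {0<..<1} x *\<^sub>R (exp (s * of_real (ln x)) / of_real x) * (g t * exp (\<phi> t * of_real (ln x)))" for x t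
    by (simp add: f_def exp_add ring_distribs)
  have norm_f: "norm (f x t) = norm (g t) * (indicator {0<..<1} x *\<^sub>R (exp ((Re s + \<rho>) * ln x) / x))" for x t
    by (auto simp: f_def norm_mult norm_divide \<phi> indicator_def)
  have "set_integrable lborel {0<..<1} (\<lambda>x. exp (of_real (Re s + \<rho>) * of_real (ln x)) / of_real x :: complex)"
    using s by (intro mellin_unit_interval_integrable) auto
  hence "integrable lborel (\<lambda>x. norm (indicator {0<..<1} x *\<^sub>R (exp (of_real (Re s + \<rho>) * of_real (ln x)) / of_real x :: complex)))"
    unfolding set_integrable_def by (rule integrable_norm)
  also have "(\<lambda>x. norm (indicator {0<..<1} x *\<^sub>R (exp (of_real (Re s + \<rho>) * of_real (ln x)) / of_real x :: complex)))
     = (\<lambda>x. indicator {0<..<1} x *\<^sub>R (exp ((Re s + \<rho>) * ln x) / x))"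
    by (auto simp: norm_divide indicator_def)
  finally have ix: "integrable lborel (\<lambda>x. indicator {0<..<1} x *\<^sub>R (exp ((Re s + \<rho>) * ln x) / x))" .
  have int: "integrable (lborel \<Otimes>\<^sub>M lborel) (case_prod f)"
  proof (rule lborel_pair.Fubini_integrable)
    show "case_prod f \<in> borel_measurable (lborel \<Otimes>\<^sub>M lborel)"
      unfolding f_def by measurable
    show "integrable lborel (\<lambda>x. LINT t|lborel. norm (case_prod f (x, t)))"
      unfolding prod.case norm_f integral_mult_left_zero by (intro integrable_mult_right ix)
    show "AE x in lborel. integrable lborel (\<lambda>t. case_prod f (x, t))"
      unfolding prod.case f_alt
      by (intro AE_I2 integrable_mult_right integrable_mult_exp_line[OF g m \<phi>])
  qed
  have inner_t: "1 / (2 * of_real pi) * (LINT t|lborel. f x t)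
      = mellin_density (line_integral g \<phi>) x * exp (of_real (ln x) * s)" for x
    unfolding f_alt by (simp add: line_integral_def mellin_density_def mult.commute[of s])
  have inner_x: "(LINT x|lborel. f x t) = g t / (s + \<phi> t)" for t
  proof -
    have "(LINT x|lborel. f x t) = (LINT x:{0<..<1}|lborel. g t * (exp ((s + \<phi> t) * of_real (ln x)) / of_real x))"
      by (simp add: f_def set_lebesgue_integral_def)
    also have "\<dots> = g t * (LINT x:{0<..<1}|lborel. exp ((s + \<phi> t) * of_real (ln x)) / of_real x)"
      by (rule set_integral_mult_right)
    also have "\<dots> = g t / (s + \<phi> t)"
      using s by (subst mellin_unit_interval) (auto simp: \<phi>)
    finally show ?thesis .
  qed
  have "integrable lborel (\<lambda>x. LINT t|lborel. f x t)"
    using lborel_pair.integrable_fst'[OF int] by simp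
  hence "integrable lborel (\<lambda>x. 1 / (2 * of_real pi) * (LINT t|lborel. f x t))"
    by (rule integrable_mult_right)
  thus "mellin_integrable (line_integral g \<phi>) s"
    unfolding inner_t mellin_integrable_def .
  have "(LINT x|lborel. LINT t|lborel. f x t) = (LINT t|lborel. LINT x|lborel. f x t)"
    by (rule lborel_pair.Fubini_integral[OF int, symmetric])
  hence "(LINT x|lborel. 1 / (2 * of_real pi) * (LINT t|lborel. f x t))
      = 1 / (2 * of_real pi) * (LINT t|lborel. g t / (s + \<phi> t))"
    unfolding inner_x by (simp only: integral_mult_right_zero)
  thus "mellin (line_integral g \<phi>) s = 1 / (2 * of_real pi) * (LINT t|lborel. g t / (s + \<phi> t))"
    unfolding inner_t mellin_def .
qed

section \<open>Moving vertical lines of integration\<close>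

lemma tendsto_symmetric_integral:
  fixes f :: "real \<Rightarrow> complex"
  assumes f: "integrable lborel f"
  shows "(\<lambda>N. integral {- real N..real N} f) \<longlonglongrightarrow> (LINT t|lborel. f t)"
proof -
  have "set_integrable lborel {- real N..real N} f" for N
    using f unfolding set_integrable_def by (rule integrable_mult_indicator[rotated]) simp
  hence eq: "integral {- real N..real N} f = (LINT t|lborel. indicator {- real N..real N} t *\<^sub>R f t)" for N
    by (simp add: set_borel_integral_eq_integral(2)[symmetric] set_lebesgue_integral_def)
  have [measurable]: "f \<in> borel_measurable lborel" using f by auto
  have "(\<lambda>N. LINT t|lborel. indicator {- real N..real N} t *\<^sub>R f t) \<longlonglongrightarrow> (LINT t|lborel. f t)"
  proof (rule integral_dominated_convergence[where w = "\<lambda>t. norm (f t)"])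
    show "AE t in lborel. (\<lambda>N. indicator {- real N..real N} t *\<^sub>R f t) \<longlonglongrightarrow> f t"
    proof (intro AE_I2 tendsto_eventually)
      fix t :: real
      obtain N0 where N0: "\<bar>t\<bar> < real N0" using reals_Archimedean2 by blast
      show "\<forall>\<^sub>F N in sequentially. indicator {- real N..real N} t *\<^sub>R f t = f t"
        using eventually_ge_at_top[of N0]
      proof eventually_elim
        case (elim N)
        hence "real N0 \<le> real N" by simp
        thus ?case using N0 by (auto simp: indicator_def)
      qed
    qed
  qed (use f in \<open>auto simp: indicator_def\<close>)
  thus ?thesis by (simp only: eq)
qed

text \<open>
The integral over the boundary of a tall rectangle tends to the difference of the integrals over
the two vertical lines, since the horizontal sides contribute \<open>O(1/T\<^sup>2)\<close>. Continuity of \<open>f\<close> may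
fail at the interior point \<open>p\<close>, which lets the lemma serve for both Cauchy's theorem and Cauchy's
integral formula.
\<close>

lemma vertical_integral_diff:
  fixes f :: "complex \<Rightarrow> complex"
  assumes ab: "a < Re p" "Re p < b"
    and ia: "integrable lborel (\<lambda>t. f (Complex a t))" and ib: "integrable lborel (\<lambda>t. f (Complex b t))"
    and cont: "continuous_on ({z. a \<le> Re z \<and> Re z \<le> b} - {p}) f"
    and bound: "\<And>\<sigma> t. a \<le> \<sigma> \<Longrightarrow> \<sigma> \<le> b \<Longrightarrow> \<bar>t\<bar> \<ge> L \<Longrightarrow> norm (f (Complex \<sigma> t)) \<le> C / t\<^sup>2"
    and J: "\<And>T. T > \<bar>Im p\<bar> \<Longrightarrow> contour_integral (rectpath (Complex a (-T)) (Complex b T)) f = J"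
  shows "\<i> * ((LINT t|lborel. f (Complex b t)) - (LINT t|lborel. f (Complex a t))) = J"
proof -
  define h where "h \<tau> = contour_integral (linepath (Complex a \<tau>) (Complex b \<tau>)) f" for \<tau>
  define N0 where "N0 = nat \<lceil>\<bar>Im p\<bar> + \<bar>L\<bar>\<rceil> + 1"
  have N0: "real N > \<bar>Im p\<bar>" "real N \<ge> L" "N > 0" if "N \<ge> N0" for N
    using that unfolding N0_def by linarith+
  have seg_h: "closed_segment (Complex a \<tau>) (Complex b \<tau>) \<subseteq> {z. a \<le> Re z \<and> Re z \<le> b \<and> Im z = \<tau>}" for \<tau>
    using ab by (auto simp: closed_segment_same_Im closed_segment_eq_real_ivl)
  have seg_v: "closed_segment (Complex c (-T)) (Complex c T) \<subseteq> {z. Re z = c}" for c T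
    by (auto simp: closed_segment_same_Re)
  have ch: "f contour_integrable_on linepath (Complex a \<tau>) (Complex b \<tau>)" if "\<tau> \<noteq> Im p" for \<tau>
    using seg_h[of \<tau>] that by (intro contour_integrable_continuous_linepath continuous_on_subset[OF cont]) auto
  have cv: "f contour_integrable_on linepath (Complex c (-T)) (Complex c T)" if "c = a \<or> c = b" for c T
    using seg_v[of c T] that ab by (intro contour_integrable_continuous_linepath continuous_on_subset[OF cont]) auto
  have hb: "norm (h \<tau>) \<le> \<bar>C\<bar> / \<tau>\<^sup>2 * (b - a)" if "\<bar>\<tau>\<bar> \<ge> L" "\<tau> \<noteq> Im p" for \<tau>
  proof -
    have "norm (h \<tau>) \<le> \<bar>C\<bar> / \<tau>\<^sup>2 * norm (Complex b \<tau> - Complex a \<tau>)"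
      unfolding h_def
    proof (rule contour_integral_bound_linepath)
      fix z assume "z \<in> closed_segment (Complex a \<tau>) (Complex b \<tau>)"
      with seg_h have z: "a \<le> Re z" "Re z \<le> b" "Im z = \<tau>" by auto
      have "norm (f (Complex (Re z) (Im z))) \<le> C / \<tau>\<^sup>2"
        unfolding z(3) using z that by (intro bound) auto
      also have "\<dots> \<le> \<bar>C\<bar> / \<tau>\<^sup>2" by (intro divide_right_mono) auto
      finally show "norm (f z) \<le> \<bar>C\<bar> / \<tau>\<^sup>2" by simp
    qed (use ch that in auto)
    also have "Complex b \<tau> - Complex a \<tau> = of_real (b - a)"
      by (simp add: complex_eq_iff)
    finally show ?thesis using ab by (simp add: norm_of_real del: of_real_diff)
  qed
  have main: "h (- real N) + \<i> * integral {- real N..real N} (\<lambda>t. f (Complex b t))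
            - h (real N) - \<i> * integral {- real N..real N} (\<lambda>t. f (Complex a t)) = J" if "N \<ge> N0" for N
  proof -
    note N = N0[OF that]
    have v: "contour_integral (linepath (Complex c (- real N)) (Complex c (real N))) f
        = \<i> * integral {- real N..real N} (\<lambda>t. f (Complex c t))" for c
      using N by (intro contour_integral_linepath_same_Re) auto
    have r1: "contour_integral (linepath (Complex b (real N)) (Complex a (real N))) f = - h (real N)"
      unfolding h_def by (subst contour_integral_reversepath[symmetric]) auto
    have r2: "contour_integral (linepath (Complex a (real N)) (Complex a (- real N))) f
       = - contour_integral (linepath (Complex a (- real N)) (Complex a (real N))) f"
      by (subst contour_integral_reversepath[symmetric]) auto
    have c1: "f contour_integrable_on linepath (Complex b (real N)) (Complex a (real N))"
      using contour_integrable_reversepath[OF _ ch[of "real N"]] N by auto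
    have c2: "f contour_integrable_on linepath (Complex a (real N)) (Complex a (- real N))"
      using contour_integrable_reversepath[OF _ cv[of a "real N"]] by auto
    have "J = contour_integral (rectpath (Complex a (- real N)) (Complex b (real N))) f"
      using J[OF N(1)] by simp
    also have "\<dots> = h (- real N) + (contour_integral (linepath (Complex b (- real N)) (Complex b (real N))) f
        + (contour_integral (linepath (Complex b (real N)) (Complex a (real N))) f
         + contour_integral (linepath (Complex a (real N)) (Complex a (- real N))) f))"
      unfolding rectpath_def Let_def h_def complex.sel using ch[of "- real N"] cv[of b "real N"] c1 c2 N
      by (subst contour_integral_join; (simp add: contour_integrable_join)?)+
    finally show ?thesis
      by (simp add: r1 r2 v)
  qed
  have h0: "(\<lambda>N. h (s * real N)) \<longlonglongrightarrow> 0" if s: "s = 1 \<or> s = -1" for s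
  proof (rule Lim_null_comparison)
    show "\<forall>\<^sub>F N in sequentially. norm (h (s * real N)) \<le> \<bar>C\<bar> / (real N)\<^sup>2 * (b - a)"
      using eventually_ge_at_top[of N0]
    proof eventually_elim
      case (elim N)
      show ?case using hb[of "s * real N"] N0[OF elim] s by (auto simp: power_mult_distrib)
    qed
    show "(\<lambda>N. \<bar>C\<bar> / (real N)\<^sup>2 * (b - a)) \<longlonglongrightarrow> 0"
      by real_asymp
  qed
  have "(\<lambda>N. h (- real N) + \<i> * integral {- real N..real N} (\<lambda>t. f (Complex b t))
            - h (real N) - \<i> * integral {- real N..real N} (\<lambda>t. f (Complex a t)))
        \<longlonglongrightarrow> 0 + \<i> * (LINT t|lborel. f (Complex b t)) - 0 - \<i> * (LINT t|lborel. f (Complex a t))"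
    using h0[of 1] h0[of "-1"] by (intro tendsto_intros tendsto_symmetric_integral ia ib) simp_all
  moreover have "(\<lambda>N. h (- real N) + \<i> * integral {- real N..real N} (\<lambda>t. f (Complex b t))
            - h (real N) - \<i> * integral {- real N..real N} (\<lambda>t. f (Complex a t))) \<longlonglongrightarrow> J"
    by (intro tendsto_eventually eventually_mono[OF eventually_ge_at_top[of N0]] main)
  ultimately show ?thesis
    using LIMSEQ_unique by (force simp: algebra_simps)
qed

text \<open>
The class of integrands whose vertical lines may be moved freely within \<open>Re s > 1\<close>. It contains
\<open>\<gamma>\<close> and \<open>\<gamma> D\<close> and is stable under the factors produced by differentiation and by powers of \<open>x\<close>.
\<close>

definition vertically_rapid :: "(complex \<Rightarrow> complex) \<Rightarrow> bool" where
  "vertically_rapid G \<longleftrightarrow> G holomorphic_on {s. Re s > 1} \<and>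
     (\<forall>a b m. 1 < a \<longrightarrow> a \<le> b \<longrightarrow> (\<exists>C. \<forall>\<sigma> t. a \<le> \<sigma> \<longrightarrow> \<sigma> \<le> b \<longrightarrow>
        norm (G (Complex \<sigma> t)) * (1 + \<bar>t\<bar>) ^ m \<le> C))"

text \<open>
Multiplication by these functions preserves \<open>vertically_rapid\<close>
(\<open>vertically_rapid_mult_moderate\<close>); Dirichlet series, affine functions and powers of \<open>x\<close> with an
affine exponent are examples.
\<close>

definition vertically_moderate :: "(complex \<Rightarrow> complex) \<Rightarrow> bool" where
  "vertically_moderate B \<longleftrightarrow> B holomorphic_on {s. Re s > 1} \<and>
     (\<forall>a b. 1 < a \<longrightarrow> a \<le> b \<longrightarrow> (\<exists>K m. \<forall>\<sigma> t. a \<le> \<sigma> \<longrightarrow> \<sigma> \<le> b \<longrightarrow>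
        norm (B (Complex \<sigma> t)) \<le> K * (1 + \<bar>t\<bar>) ^ m))"

lemma vertically_rapid_mult_moderate:
  assumes G: "vertically_rapid G" and B: "vertically_moderate B"
  shows "vertically_rapid (\<lambda>s. G s * B s)"
  unfolding vertically_rapid_def
proof (intro conjI allI impI)
  show "(\<lambda>s. G s * B s) holomorphic_on {s. Re s > 1}"
    using assms by (auto simp: vertically_rapid_def vertically_moderate_def intro!: holomorphic_intros)
next
  fix a b :: real and m :: nat
  assume ab: "1 < a" "a \<le> b"
  obtain K k where K: "\<And>\<sigma> t. a \<le> \<sigma> \<Longrightarrow> \<sigma> \<le> b \<Longrightarrow> norm (B (Complex \<sigma> t)) \<le> K * (1 + \<bar>t\<bar>) ^ k"
    using B ab unfolding vertically_moderate_def by meson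
  obtain C where C: "\<And>\<sigma> t. a \<le> \<sigma> \<Longrightarrow> \<sigma> \<le> b \<Longrightarrow> norm (G (Complex \<sigma> t)) * (1 + \<bar>t\<bar>) ^ (m + k) \<le> C"
    using G ab unfolding vertically_rapid_def by meson
  have "norm (G (Complex \<sigma> t) * B (Complex \<sigma> t)) * (1 + \<bar>t\<bar>) ^ m \<le> C * \<bar>K\<bar>" if \<sigma>: "a \<le> \<sigma>" "\<sigma> \<le> b" for \<sigma> t
  proof -
    have "norm (B (Complex \<sigma> t)) \<le> \<bar>K\<bar> * (1 + \<bar>t\<bar>) ^ k"
      using K[OF \<sigma>, of t] by (rule order_trans) (auto intro!: mult_right_mono)
    hence "(norm (G (Complex \<sigma> t)) * (1 + \<bar>t\<bar>) ^ m) * norm (B (Complex \<sigma> t))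
        \<le> (norm (G (Complex \<sigma> t)) * (1 + \<bar>t\<bar>) ^ m) * (\<bar>K\<bar> * (1 + \<bar>t\<bar>) ^ k)"
      by (rule mult_left_mono) auto
    hence "norm (G (Complex \<sigma> t) * B (Complex \<sigma> t)) * (1 + \<bar>t\<bar>) ^ m
        \<le> (norm (G (Complex \<sigma> t)) * (1 + \<bar>t\<bar>) ^ m) * (\<bar>K\<bar> * (1 + \<bar>t\<bar>) ^ k)"
      by (simp add: norm_mult mult_ac)
    also have "\<dots> = (norm (G (Complex \<sigma> t)) * (1 + \<bar>t\<bar>) ^ (m + k)) * \<bar>K\<bar>"
      by (simp add: power_add)
    also have "\<dots> \<le> C * \<bar>K\<bar>"
      using C[OF \<sigma>] by (intro mult_right_mono) auto
    finally show ?thesis .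
  qed
  thus "\<exists>C. \<forall>\<sigma> t. a \<le> \<sigma> \<longrightarrow> \<sigma> \<le> b \<longrightarrow> norm (G (Complex \<sigma> t) * B (Complex \<sigma> t)) * (1 + \<bar>t\<bar>) ^ m \<le> C"
    by blast
qed

lemma vertically_moderate_linear: "vertically_moderate (\<lambda>s. c * s + d)"
  unfolding vertically_moderate_def
proof (intro conjI allI impI)
  fix a b :: real assume ab: "1 < a" "a \<le> b"
  have "norm (c * Complex \<sigma> t + d) \<le> (norm c * (b + 1) + norm d) * (1 + \<bar>t\<bar>) ^ 1" if \<sigma>: "a \<le> \<sigma>" "\<sigma> \<le> b" for \<sigma> t
  proof -
    have "norm (Complex \<sigma> t) \<le> \<bar>\<sigma>\<bar> + \<bar>t\<bar>"
      using cmod_le[of "Complex \<sigma> t"] by simp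
    also have "\<dots> \<le> b + \<bar>t\<bar>" using \<sigma> ab by auto
    also have "\<dots> \<le> (b + 1) * (1 + \<bar>t\<bar>)" using \<sigma> ab by (simp add: algebra_simps)
    finally have "norm c * norm (Complex \<sigma> t) \<le> norm c * ((b + 1) * (1 + \<bar>t\<bar>))"
      by (intro mult_left_mono) auto
    moreover have "norm d \<le> norm d * (1 + \<bar>t\<bar>)"
      by (simp add: algebra_simps)
    moreover have "norm (c * Complex \<sigma> t + d) \<le> norm c * norm (Complex \<sigma> t) + norm d"
      by (metis norm_mult norm_triangle_ineq)
    ultimately have "norm (c * Complex \<sigma> t + d) \<le> norm c * ((b + 1) * (1 + \<bar>t\<bar>)) + norm d * (1 + \<bar>t\<bar>)"
      by linarith
    thus ?thesis by (simp add: algebra_simps)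
  qed
  thus "\<exists>K m. \<forall>\<sigma> t. a \<le> \<sigma> \<longrightarrow> \<sigma> \<le> b \<longrightarrow> norm (c * Complex \<sigma> t + d) \<le> K * (1 + \<bar>t\<bar>) ^ m"
    by blast
qed (intro holomorphic_intros)

lemma vertically_moderate_exp_linear: "vertically_moderate (\<lambda>s. exp ((of_real c * s + of_real d) * of_real u))"
  unfolding vertically_moderate_def
proof (intro conjI allI impI)
  fix a b :: real assume ab: "1 < a" "a \<le> b"
  have "norm (exp ((of_real c * Complex \<sigma> t + of_real d) * of_real u)) \<le> exp ((\<bar>c\<bar> * b + \<bar>d\<bar>) * \<bar>u\<bar>) * (1 + \<bar>t\<bar>) ^ 0"
    if \<sigma>: "a \<le> \<sigma>" "\<sigma> \<le> b" for \<sigma> t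
  proof -
    have "\<bar>c * \<sigma> + d\<bar> \<le> \<bar>c\<bar> * \<bar>\<sigma>\<bar> + \<bar>d\<bar>"
      using abs_triangle_ineq[of "c * \<sigma>" d] by (simp add: abs_mult)
    also have "\<dots> \<le> \<bar>c\<bar> * b + \<bar>d\<bar>"
      using \<sigma> ab by (intro add_right_mono mult_left_mono) auto
    finally have "(c * \<sigma> + d) * u \<le> (\<bar>c\<bar> * b + \<bar>d\<bar>) * \<bar>u\<bar>"
      using abs_ge_self[of "(c * \<sigma> + d) * u"] mult_right_mono[of "\<bar>c * \<sigma> + d\<bar>" "\<bar>c\<bar> * b + \<bar>d\<bar>" "\<bar>u\<bar>"]
      by (simp add: abs_mult)
    thus ?thesis by simp
  qed
  thus "\<exists>K m. \<forall>\<sigma> t. a \<le> \<sigma> \<longrightarrow> \<sigma> \<le> b \<longrightarrow>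
      norm (exp ((of_real c * Complex \<sigma> t + of_real d) * of_real u)) \<le> K * (1 + \<bar>t\<bar>) ^ m"
    by blast
qed (intro holomorphic_intros)

lemma continuous_on_Complex_line: "continuous_on UNIV (\<lambda>t. Complex a t)"
  unfolding Complex_eq by (intro continuous_intros)

lemma integrable_inverse_one_plus_square: "integrable lborel (\<lambda>t::real. 1 / (1 + t\<^sup>2))"
  using integrable_inverse_1_plus_square by (simp add: set_integrable_def inverse_eq_divide)

lemma vertically_rapid_bound:
  assumes "vertically_rapid G" "1 < a" "a \<le> b"
  shows "\<exists>C\<ge>0. \<forall>\<sigma> t. a \<le> \<sigma> \<longrightarrow> \<sigma> \<le> b \<longrightarrow> norm (G (Complex \<sigma> t)) \<le> C / (1 + t\<^sup>2)"
proof -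
  obtain C where C: "\<And>\<sigma> t. a \<le> \<sigma> \<Longrightarrow> \<sigma> \<le> b \<Longrightarrow> norm (G (Complex \<sigma> t)) * (1 + \<bar>t\<bar>) ^ 2 \<le> C"
    using assms unfolding vertically_rapid_def by meson
  show ?thesis
  proof (intro exI[of _ C] conjI allI impI)
    fix \<sigma> t assume "a \<le> \<sigma>" "\<sigma> \<le> b"
    have "norm (G (Complex \<sigma> t)) * (1 + t\<^sup>2) \<le> norm (G (Complex \<sigma> t)) * (1 + \<bar>t\<bar>) ^ 2"
      by (intro mult_left_mono) (auto simp: power2_eq_square algebra_simps)
    also have "\<dots> \<le> C" by (rule C) fact+
    finally show "norm (G (Complex \<sigma> t)) \<le> C / (1 + t\<^sup>2)"
      by (simp add: pos_le_divide_eq add_pos_nonneg)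
  next
    have "norm (G (Complex a 0)) * (1 + \<bar>0::real\<bar>) ^ 2 \<le> C" using assms by (intro C) auto
    thus "C \<ge> 0" using order_trans[OF norm_ge_zero[of "G (Complex a 0)"]] by simp
  qed
qed

lemma vertically_rapid_continuous_line:
  assumes "vertically_rapid G" "1 < a"
  shows "continuous_on UNIV (\<lambda>t. G (Complex a t))"
proof (rule continuous_on_compose2[OF _ continuous_on_Complex_line])
  show "continuous_on {s. Re s > 1} G"
    using assms by (auto simp: vertically_rapid_def intro: holomorphic_on_imp_continuous_on)
qed (use assms in auto)

lemma vertically_rapid_integrable:
  assumes "vertically_rapid G" "1 < a"
  shows "integrable lborel (\<lambda>t. G (Complex a t))"
proof -
  obtain C where C: "\<And>\<sigma> t. a \<le> \<sigma> \<Longrightarrow> \<sigma> \<le> a \<Longrightarrow> norm (G (Complex \<sigma> t)) \<le> C / (1 + t\<^sup>2)"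
    using vertically_rapid_bound[OF assms order_refl] by metis
  show ?thesis
  proof (rule Bochner_Integration.integrable_bound[OF integrable_mult_right[OF integrable_inverse_one_plus_square, of C]])
    show "(\<lambda>t. G (Complex a t)) \<in> borel_measurable lborel"
      using vertically_rapid_continuous_line[OF assms] by (simp add: borel_measurable_continuous_onI)
    show "AE t in lborel. norm (G (Complex a t)) \<le> norm (C * (1 / (1 + t\<^sup>2)))"
    proof (intro AE_I2)
      fix t
      have "norm (G (Complex a t)) \<le> C / (1 + t\<^sup>2)" by (rule C) auto
      also have "\<dots> \<le> norm (C * (1 / (1 + t\<^sup>2)))"
        using abs_ge_self[of "C / (1 + t\<^sup>2)"] by simp
      finally show "norm (G (Complex a t)) \<le> norm (C * (1 / (1 + t\<^sup>2)))" .
    qed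
  qed
qed

lemma open_Re_gt: "open {s. Re s > c}"
  by (intro open_Collect_less continuous_intros)

lemma rectpath_in_right_half_plane:
  assumes "c < a" "a \<le> b" "T \<ge> 0"
  shows "path_image (rectpath (Complex a (-T)) (Complex b T)) \<subseteq> {s. Re s > c}"
  using path_image_rectpath_subset_cbox[of "Complex a (-T)" "Complex b T"] assms
  by (auto simp: in_cbox_complex_iff)

text \<open>
Cauchy's integral formula for the strip \<open>a < Re s < b\<close>. Read from left to right it is the residue
picked up when the line is moved across the pole of \<open>1/(s - p)\<close>.
\<close>

lemma vertical_cauchy_formula:
  assumes G: "vertically_rapid G" and ap: "1 < a" "a < Re p" "Re p < b"
  shows "(LINT t|lborel. G (Complex b t) / (Complex b t - p)) - (LINT t|lborel. G (Complex a t) / (Complex a t - p))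
           = 2 * of_real pi * G p"
proof -
  have hol: "G holomorphic_on {s. Re s > 1}" using G by (simp add: vertically_rapid_def)
  obtain C where C: "\<And>\<sigma> t. a \<le> \<sigma> \<Longrightarrow> \<sigma> \<le> b \<Longrightarrow> norm (G (Complex \<sigma> t)) \<le> C / (1 + t\<^sup>2)" "C \<ge> 0"
    using vertically_rapid_bound[OF G ap(1) less_imp_le[OF less_trans[OF ap(2,3)]]] by metis
  have int: "integrable lborel (\<lambda>t. G (Complex c t) / (Complex c t - p))" if c: "c > 1" "c \<noteq> Re p" for c
  proof (rule Bochner_Integration.integrable_bound[OF integrable_mult_right[OF integrable_norm[OF vertically_rapid_integrable[OF G c(1)]], of "1 / \<bar>c - Re p\<bar>"]])
    have "continuous_on UNIV (\<lambda>t. G (Complex c t) / (Complex c t - p))"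
      using c by (intro continuous_intros vertically_rapid_continuous_line[OF G] continuous_on_Complex_line) auto
    thus "(\<lambda>t. G (Complex c t) / (Complex c t - p)) \<in> borel_measurable lborel"
      by (simp add: borel_measurable_continuous_onI)
    show "AE t in lborel. norm (G (Complex c t) / (Complex c t - p)) \<le> norm (1 / \<bar>c - Re p\<bar> * norm (G (Complex c t)))"
    proof (intro AE_I2)
      fix t
      have "\<bar>c - Re p\<bar> \<le> norm (Complex c t - p)"
        using abs_Re_le_cmod[of "Complex c t - p"] by simp
      thus "norm (G (Complex c t) / (Complex c t - p)) \<le> norm (1 / \<bar>c - Re p\<bar> * norm (G (Complex c t)))"
        using c by (auto simp: norm_divide intro!: divide_left_mono mult_pos_pos)
    qed
  qed
  have "\<i> * ((LINT t|lborel. G (Complex b t) / (Complex b t - p)) - (LINT t|lborel. G (Complex a t) / (Complex a t - p)))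
           = 2 * of_real pi * \<i> * G p"
  proof (rule vertical_integral_diff[where f = "\<lambda>w. G w / (w - p)" and p = p and L = "\<bar>Im p\<bar> + 1" and C = C])
    show "continuous_on ({z. a \<le> Re z \<and> Re z \<le> b} - {p}) (\<lambda>w. G w / (w - p))"
      using ap by (intro continuous_intros continuous_on_subset[OF holomorphic_on_imp_continuous_on[OF hol]]) auto
  next
    fix \<sigma> t assume *: "a \<le> \<sigma>" "\<sigma> \<le> b" "\<bar>Im p\<bar> + 1 \<le> \<bar>t\<bar>"
    have "1 \<le> norm (Complex \<sigma> t - p)"
      using abs_Im_le_cmod[of "Complex \<sigma> t - p"] * by auto
    hence "norm (G (Complex \<sigma> t)) / norm (Complex \<sigma> t - p) \<le> norm (G (Complex \<sigma> t)) / 1"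
      by (intro divide_left_mono) auto
    also have "\<dots> = norm (G (Complex \<sigma> t))" by simp
    also have "\<dots> \<le> C / (1 + t\<^sup>2)" using * by (intro C)
    also have "\<dots> \<le> C / t\<^sup>2"
    proof (intro divide_left_mono mult_pos_pos)
      show "0 < t\<^sup>2" using * by auto
      thus "0 < 1 + t\<^sup>2" by linarith
    qed (use C(2) in auto)
    finally show "norm (G (Complex \<sigma> t) / (Complex \<sigma> t - p)) \<le> C / t\<^sup>2" by (simp add: norm_divide)
  next
    fix T assume T: "T > \<bar>Im p\<bar>"
    have T0: "T \<ge> 0" using T by linarith
    have pbox: "p \<in> box (Complex a (-T)) (Complex b T)"
      using ap T by (auto simp: in_box_complex_iff)
    have "((\<lambda>w. G w / (w - p)) has_contour_integral 2 * pi * \<i> * winding_number (rectpath (Complex a (-T)) (Complex b T)) p * G p)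
            (rectpath (Complex a (-T)) (Complex b T))"
    proof (rule Cauchy_integral_formula_convex_simple[OF convex_halfspace_Re_gt hol])
      show "p \<in> interior {s. Re s > 1}"
        using ap by (subst interior_open[OF open_Re_gt]) auto
      have "path_image (rectpath (Complex a (-T)) (Complex b T)) \<inter> box (Complex a (-T)) (Complex b T) = {}"
        using ap T by (intro path_image_rectpath_inter_box) simp_all
      with pbox have "p \<notin> path_image (rectpath (Complex a (-T)) (Complex b T))"
        by blast
      thus "path_image (rectpath (Complex a (-T)) (Complex b T)) \<subseteq> {s. Re s > 1} - {p}"
        using rectpath_in_right_half_plane[of 1 a b T] ap T0 by auto
    qed auto
    moreover have "winding_number (rectpath (Complex a (-T)) (Complex b T)) p = 1"
      using pbox by (rule winding_number_rectpath)
    ultimately show "contour_integral (rectpath (Complex a (-T)) (Complex b T)) (\<lambda>w. G w / (w - p)) = 2 * of_real pi * \<i> * G p"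
      by (simp add: contour_integral_unique)
  qed (use ap int in auto)
  thus ?thesis by (simp add: mult.commute mult.left_commute)
qed

lemma vertical_integral_independent:
  assumes G: "vertically_rapid G" and a: "1 < a" and b: "1 < b"
  shows "(LINT t|lborel. G (Complex a t)) = (LINT t|lborel. G (Complex b t))"
proof -
  have *: "(LINT t|lborel. G (Complex a t)) = (LINT t|lborel. G (Complex b t))" if ab: "1 < a" "a < b" for a b
  proof -
    have hol: "G holomorphic_on {s. Re s > 1}" using G by (simp add: vertically_rapid_def)
    obtain C where C: "\<And>\<sigma> t. a \<le> \<sigma> \<Longrightarrow> \<sigma> \<le> b \<Longrightarrow> norm (G (Complex \<sigma> t)) \<le> C / (1 + t\<^sup>2)" "C \<ge> 0"
      using vertically_rapid_bound[OF G ab(1) less_imp_le[OF ab(2)]] by metis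
    have "\<i> * ((LINT t|lborel. G (Complex b t)) - (LINT t|lborel. G (Complex a t))) = 0"
    \<comment> \<open>The integrand is continuous throughout; any point strictly between the lines may serve as \<open>p\<close>.\<close>
    proof (rule vertical_integral_diff[where p = "of_real ((a + b) / 2)" and L = 1 and C = C])
      show "continuous_on ({z. a \<le> Re z \<and> Re z \<le> b} - {of_real ((a + b) / 2)}) G"
        using ab by (intro continuous_on_subset[OF holomorphic_on_imp_continuous_on[OF hol]]) auto
    next
      fix \<sigma> t :: real assume *: "a \<le> \<sigma>" "\<sigma> \<le> b" "1 \<le> \<bar>t\<bar>"
      have "norm (G (Complex \<sigma> t)) \<le> C / (1 + t\<^sup>2)" using * by (intro C)
      also have "\<dots> \<le> C / t\<^sup>2"
    proof (intro divide_left_mono mult_pos_pos)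
      show "0 < t\<^sup>2" using * by auto
      thus "0 < 1 + t\<^sup>2" by linarith
    qed (use C(2) in auto)
      finally show "norm (G (Complex \<sigma> t)) \<le> C / t\<^sup>2" .
    next
      fix T :: real assume T: "T > \<bar>Im (of_real ((a + b) / 2))\<bar>"
      show "contour_integral (rectpath (Complex a (-T)) (Complex b T)) G = 0"
        by (rule contour_integral_unique, rule Cauchy_theorem_convex_simple[OF hol convex_halfspace_Re_gt])
           (use rectpath_in_right_half_plane[of 1 a b T] ab T in auto)
    next
      show "integrable lborel (\<lambda>t. G (Complex a t))" "integrable lborel (\<lambda>t. G (Complex b t))"
        using ab by (intro vertically_rapid_integrable[OF G]; linarith)+
    qed (use ab in simp_all)
    thus ?thesis by simp
  qed
  show ?thesis
    using *[OF a, of b] *[OF b, of a] by (metis linorder_less_linear)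
qed

section \<open>Inverse Mellin transforms with affine exponents\<close>

text \<open>
The integrand is \<open>G(s) x^{cs+d}\<close> on the line \<open>Re s = a\<close>. The pairs \<open>(c, d) = (n, 0)\<close> and
\<open>(- n, n)\<close> give the two parts of \<open>h\<close>.
\<close>

definition vertical_transform :: "(complex \<Rightarrow> complex) \<Rightarrow> real \<Rightarrow> real \<Rightarrow> real \<Rightarrow> real \<Rightarrow> complex" where
  "vertical_transform G c d a = line_integral (\<lambda>t. G (Complex a t)) (\<lambda>t. of_real c * Complex a t + of_real d)"

lemma affine_along_line:
  "(\<lambda>t. of_real c * Complex a t + of_real d) \<in> borel_measurable lborel"
  "Re (of_real c * Complex a t + of_real d) = c * a + d"
proof -
  have "continuous_on UNIV (\<lambda>t. of_real c * Complex a t + of_real d :: complex)"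
    by (intro continuous_intros continuous_on_Complex_line)
  thus "(\<lambda>t. of_real c * Complex a t + of_real d) \<in> borel_measurable lborel"
    by (simp add: borel_measurable_continuous_onI)
qed simp

lemma vertical_transform_independent:
  assumes G: "vertically_rapid G" and "1 < a" "1 < b"
  shows "vertical_transform G c d a x = vertical_transform G c d b x"
proof -
  have "vertically_rapid (\<lambda>s. G s * exp ((of_real c * s + of_real d) * of_real (ln x)))"
    by (intro vertically_rapid_mult_moderate G vertically_moderate_exp_linear)
  from vertical_integral_independent[OF this assms(2,3)] show ?thesis
    by (simp add: vertical_transform_def line_integral_def)
qed

lemma vertical_transform_has_vector_derivative:
  assumes G: "vertically_rapid G" and a: "1 < a" and x: "x > 0"
  shows "(vertical_transform G c d a has_vector_derivative
           - (1 / x) *\<^sub>R vertical_transform (\<lambda>s. G s * - (of_real c * s + of_real d)) c d a x) (at x)"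
proof -
  let ?l = "\<lambda>s. of_real c * s + of_real d"
  have 1: "vertically_rapid (\<lambda>s. G s * ?l s)"
    by (intro vertically_rapid_mult_moderate G vertically_moderate_linear)
  have 2: "vertically_rapid (\<lambda>s. G s * ?l s * ?l s)"
    by (intro vertically_rapid_mult_moderate 1 vertically_moderate_linear)
  have "(vertical_transform G c d a has_vector_derivative
           (1 / x) *\<^sub>R line_integral (\<lambda>t. G (Complex a t) * ?l (Complex a t)) (\<lambda>t. ?l (Complex a t)) x) (at x)"
    unfolding vertical_transform_def
    by (rule line_integral_has_vector_derivative)
       (use vertically_rapid_integrable[OF G a] vertically_rapid_integrable[OF 1 a] vertically_rapid_integrable[OF 2 a] affine_along_line x
         in \<open>simp_all add: power2_eq_square mult.assoc\<close>)
  also have "line_integral (\<lambda>t. G (Complex a t) * ?l (Complex a t)) (\<lambda>t. ?l (Complex a t)) x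
      = - vertical_transform (\<lambda>s. G s * - ?l s) c d a x"
    by (simp only: vertical_transform_def line_integral_def mult_minus_right mult_minus_left
          Bochner_Integration.integral_minus minus_minus)
  finally show ?thesis by simp
qed

text \<open>
The line \<open>a\<close> on which the transform is defined may be replaced by any other line \<open>b > 1\<close>, so
convergence holds as soon as some \<open>b > 1\<close> satisfies the inequality.
\<close>

lemma vertical_transform_mellin:
  assumes G: "vertically_rapid G" and a: "1 < a" and b: "1 < b" and z: "Re z + (c * b + d) > 0"
  shows "mellin_integrable (vertical_transform G c d a) z"
    and "mellin (vertical_transform G c d a) z
           = 1 / (2 * of_real pi) * (LINT t|lborel. G (Complex b t) / (z + (of_real c * Complex b t + of_real d)))"
proof -
  note li = line_integral_mellin_integrable line_integral_mellin
  note * = li[OF vertically_rapid_integrable[OF G b] affine_along_line[where c = c and a = b and d = d], of z]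
  have eq: "vertical_transform G c d a = vertical_transform G c d b"
    using vertical_transform_independent[OF G a b] by blast
  show "mellin_integrable (vertical_transform G c d a) z"
    using *(1) z unfolding eq unfolding vertical_transform_def by simp
  show "mellin (vertical_transform G c d a) z
           = 1 / (2 * of_real pi) * (LINT t|lborel. G (Complex b t) / (z + (of_real c * Complex b t + of_real d)))"
    using *(2) z unfolding eq unfolding vertical_transform_def by simp
qed

lemma integrable_divide_affine_line:
  assumes G: "vertically_rapid G" and b: "1 < b" and z: "Re z + (c * b + d) \<noteq> 0"
  shows "integrable lborel (\<lambda>t. G (Complex b t) / (z + (of_real c * Complex b t + of_real d)))"
proof (rule Bochner_Integration.integrable_bound[OF integrable_mult_right[OF integrable_norm[OF vertically_rapid_integrable[OF G b]], of "1 / \<bar>Re z + (c * b + d)\<bar>"]])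
  note nz = z
  have [measurable]: "(\<lambda>t. of_real c * Complex b t + of_real d) \<in> borel_measurable lborel"
    by (rule affine_along_line)
  have [measurable]: "(\<lambda>t. G (Complex b t)) \<in> borel_measurable lborel"
    using vertically_rapid_integrable[OF G b] by auto
  show "(\<lambda>t. G (Complex b t) / (z + (of_real c * Complex b t + of_real d))) \<in> borel_measurable lborel"
    by measurable
  show "AE t in lborel. norm (G (Complex b t) / (z + (of_real c * Complex b t + of_real d)))
      \<le> norm (1 / \<bar>Re z + (c * b + d)\<bar> * norm (G (Complex b t)))"
  proof (intro AE_I2)
    fix t
    have "\<bar>Re z + (c * b + d)\<bar> \<le> norm (z + (of_real c * Complex b t + of_real d))"
      using abs_Re_le_cmod[of "z + (of_real c * Complex b t + of_real d)"] by simp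
    thus "norm (G (Complex b t) / (z + (of_real c * Complex b t + of_real d)))
      \<le> norm (1 / \<bar>Re z + (c * b + d)\<bar> * norm (G (Complex b t)))"
      using nz by (auto simp: norm_divide intro!: divide_left_mono mult_pos_pos)
  qed
qed

text \<open>
The Mellin side of \<open>- x d/dx\<close> is multiplication by \<open>z\<close> up to the boundary value at \<open>x = 1\<close>.
Instead of integrating by parts, one applies the identity \<open>- l/(z + l) = z/(z + l) - 1\<close> under
the integral over the vertical line, with \<open>l\<close> the exponent.
\<close>

lemma mellin_vertical_transform_recurrence:
  assumes G: "vertically_rapid G" and a: "1 < a" and b: "1 < b" and z: "Re z + (c * b + d) > 0"
  shows "mellin (vertical_transform (\<lambda>s. G s * - (of_real c * s + of_real d)) c d a) z
       = z * mellin (vertical_transform G c d a) z - vertical_transform G c d a 1"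
proof -
  let ?l = "\<lambda>s. of_real c * s + of_real d"
  have "vertically_rapid (\<lambda>s. G s * (of_real (-c) * s + of_real (-d)))"
    by (intro vertically_rapid_mult_moderate G vertically_moderate_linear)
  hence 1: "vertically_rapid (\<lambda>s. G s * - ?l s)"
    by simp
  have nz: "z + ?l (Complex b t) \<noteq> 0" for t
  proof
    assume "z + ?l (Complex b t) = 0"
    hence "Re (z + ?l (Complex b t)) = 0" by simp
    with z show False by simp
  qed
  define q where "q t = G (Complex b t) / (z + ?l (Complex b t))" for t
  have q: "integrable lborel q"
    using integrable_divide_affine_line[OF G b, of z c d] z by (simp add: q_def[abs_def])
  have pw: "G (Complex b t) * - ?l (Complex b t) / (z + ?l (Complex b t)) = z * q t - G (Complex b t)" for t
    using nz[of t] by (simp add: q_def field_simps)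
  have "mellin (vertical_transform (\<lambda>s. G s * - ?l s) c d a) z
      = 1 / (2 * of_real pi) * (LINT t|lborel. z * q t - G (Complex b t))"
    unfolding vertical_transform_mellin(2)[OF 1 a b z] pw ..
  also have "\<dots> = z * (1 / (2 * of_real pi) * integral\<^sup>L lborel q)
      - 1 / (2 * of_real pi) * (LINT t|lborel. G (Complex b t))"
    using q vertically_rapid_integrable[OF G b] by (simp add: right_diff_distrib diff_divide_distrib)
  also have "1 / (2 * of_real pi) * (LINT t|lborel. G (Complex b t)) = vertical_transform G c d b 1"
    by (simp add: vertical_transform_def line_integral_def)
  also have "vertical_transform G c d b 1 = vertical_transform G c d a 1"
    by (rule vertical_transform_independent[OF G b a])
  finally show ?thesis
    by (simp only: vertical_transform_mellin(2)[OF G a b z] q_def[abs_def])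
qed

lemma of_real_powr_exp: "x > 0 \<Longrightarrow> of_real x powr z = exp (z * of_real (ln x))"
  for x :: real and z :: complex
  by (simp add: powr_def Ln_of_real)

section \<open>The product of the gamma factor and the Dirichlet series\<close>

text \<open>
For large \<open>\<bar>t\<bar>\<close> the decay hypothesis with exponent \<open>m + 1\<close> beats \<open>(1 + \<bar>t\<bar>)^m\<close>; the rest of the
strip is compact and avoids the pole.
\<close>

lemma vertically_rapid_gamma:
  assumes "cond_gamma1 \<gamma>" "cond_gamma3 \<gamma>"
  shows "vertically_rapid \<gamma>"
  unfolding vertically_rapid_def
proof (intro conjI allI impI)
  have hol: "\<gamma> holomorphic_on (- {1})" using assms by (simp add: cond_gamma1_def)
  show "\<gamma> holomorphic_on {s. Re s > 1}"
    by (rule holomorphic_on_subset[OF hol]) auto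
  fix a b :: real and m :: nat assume ab: "1 < a" "a \<le> b"
  obtain t0 C where C: "\<And>\<sigma> t. a \<le> \<sigma> \<Longrightarrow> \<sigma> \<le> b \<Longrightarrow> \<bar>t\<bar> \<ge> t0 \<Longrightarrow> norm (\<gamma> (Complex \<sigma> t)) \<le> C * \<bar>t\<bar> powr (- real (Suc m))"
    using assms(2) ab unfolding cond_gamma3_def by (metis of_nat_0_less_iff zero_less_Suc)
  define T where "T = max t0 1"
  have "compact (\<gamma> ` cbox (Complex a (-T)) (Complex b T))"
    by (intro compact_continuous_image continuous_on_subset[OF holomorphic_on_imp_continuous_on[OF hol]])
       (use ab in \<open>auto simp: in_cbox_complex_iff\<close>)
  hence "bounded (\<gamma> ` cbox (Complex a (-T)) (Complex b T))"
    by (rule compact_imp_bounded)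
  then obtain B where B: "\<And>s. s \<in> cbox (Complex a (-T)) (Complex b T) \<Longrightarrow> norm (\<gamma> s) \<le> B"
    unfolding bounded_iff by blast
  show "\<exists>C. \<forall>\<sigma> t. a \<le> \<sigma> \<longrightarrow> \<sigma> \<le> b \<longrightarrow> norm (\<gamma> (Complex \<sigma> t)) * (1 + \<bar>t\<bar>) ^ m \<le> C"
  proof (intro exI allI impI)
    fix \<sigma> t assume \<sigma>: "a \<le> \<sigma>" "\<sigma> \<le> b"
    show "norm (\<gamma> (Complex \<sigma> t)) * (1 + \<bar>t\<bar>) ^ m \<le> \<bar>B\<bar> * (1 + T) ^ m + \<bar>C\<bar> * 2 ^ m"
    proof (cases "\<bar>t\<bar> \<le> T")
      case True
      have "norm (\<gamma> (Complex \<sigma> t)) \<le> \<bar>B\<bar>"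
        using \<sigma> True by (intro order_trans[OF B]) (auto simp: in_cbox_complex_iff)
      hence "norm (\<gamma> (Complex \<sigma> t)) * (1 + \<bar>t\<bar>) ^ m \<le> \<bar>B\<bar> * (1 + T) ^ m"
        using True by (intro mult_mono power_mono) auto
      also have "\<dots> \<le> \<bar>B\<bar> * (1 + T) ^ m + \<bar>C\<bar> * 2 ^ m" by simp
      finally show ?thesis .
    next
      case False
      hence t: "\<bar>t\<bar> \<ge> t0" "\<bar>t\<bar> \<ge> 1" by (auto simp: T_def)
      have pow: "\<bar>t\<bar> powr (- real (Suc m)) * \<bar>t\<bar> ^ m \<le> 1"
      proof -
        have "\<bar>t\<bar> powr (- real (Suc m)) * \<bar>t\<bar> ^ m = \<bar>t\<bar> powr (-1)"
          using t by (simp add: powr_realpow[symmetric] powr_add[symmetric] del: of_nat_Suc) simp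
        also have "\<dots> \<le> 1" using t by (simp add: powr_minus inverse_le_1_iff)
        finally show ?thesis .
      qed
      have "norm (\<gamma> (Complex \<sigma> t)) \<le> C * \<bar>t\<bar> powr (- real (Suc m))"
        by (rule C) (use \<sigma> t in auto)
      also have "\<dots> \<le> \<bar>C\<bar> * \<bar>t\<bar> powr (- real (Suc m))"
        by (intro mult_right_mono) auto
      finally have "norm (\<gamma> (Complex \<sigma> t)) * (1 + \<bar>t\<bar>) ^ m \<le> (\<bar>C\<bar> * \<bar>t\<bar> powr (- real (Suc m))) * (2 * \<bar>t\<bar>) ^ m"
        using t by (intro mult_mono power_mono) auto
      also have "\<dots> = \<bar>C\<bar> * 2 ^ m * (\<bar>t\<bar> powr (- real (Suc m)) * \<bar>t\<bar> ^ m)"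
        by (simp add: power_mult_distrib mult_ac)
      also have "\<dots> \<le> \<bar>C\<bar> * 2 ^ m * 1"
        using pow by (intro mult_left_mono) auto
      also have "\<dots> \<le> \<bar>B\<bar> * (1 + T) ^ m + \<bar>C\<bar> * 2 ^ m"
        by (auto simp: T_def)
      finally show ?thesis .
    qed
  qed
qed

text \<open>
The growth bound is used with \<open>\<eta> = (a - 1)/2\<close>, which leaves the exponent \<open>- (a + 1)/2 < - 1\<close>.
\<close>

lemma summable_dirichlet:
  assumes c: "cond_c1 c" and a: "a > 1"
  shows "summable (\<lambda>\<nu>. c (Suc \<nu>) * real (Suc \<nu>) powr (- a))"
proof -
  from c a obtain M where M: "\<And>\<nu>. \<nu> \<ge> 1 \<Longrightarrow> 0 \<le> c \<nu> \<and> c \<nu> \<le> M * real \<nu> powr ((a - 1) / 2)"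
    unfolding cond_c1_def by (metis diff_gt_0_iff_gt half_gt_zero_iff)
  have "summable (\<lambda>\<nu>. real \<nu> powr (- (a + 1) / 2))"
    using a by (subst summable_real_powr_iff) auto
  hence "summable (\<lambda>\<nu>. M * real (Suc \<nu>) powr (- (a + 1) / 2))"
    by (intro summable_mult) (subst summable_Suc_iff)
  moreover have "norm (c (Suc \<nu>) * real (Suc \<nu>) powr (- a)) \<le> M * real (Suc \<nu>) powr (- (a + 1) / 2)" for \<nu>
  proof -
    have "norm (c (Suc \<nu>) * real (Suc \<nu>) powr (- a)) \<le> (M * real (Suc \<nu>) powr ((a - 1) / 2)) * real (Suc \<nu>) powr (- a)"
      using M[of "Suc \<nu>"] by (auto simp: abs_mult intro!: mult_right_mono)
    also have "\<dots> = M * real (Suc \<nu>) powr ((a - 1) / 2 + (- a))"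
      by (simp only: powr_add mult.assoc)
    also have "(a - 1) / 2 + (- a) = - (a + 1) / 2" by (simp add: field_simps)
    finally show ?thesis .
  qed
  ultimately show ?thesis
    by (rule summable_comparison_test'[where N = 0])
qed

lemma cond_c1_nonneg: "cond_c1 c \<Longrightarrow> 0 \<le> c (Suc \<nu>)"
  unfolding cond_c1_def by (metis One_nat_def Suc_le_mono le0 zero_less_one)

lemma norm_dirichlet_term:
  assumes "cond_c1 c"
  shows "norm (of_real (c (Suc \<nu>)) * of_nat (Suc \<nu>) powr (- s) :: complex) = c (Suc \<nu>) * real (Suc \<nu>) powr (- Re s)"
proof -
  have "(of_nat (Suc \<nu>) :: complex) powr (- s) = of_real (real (Suc \<nu>)) powr (- s)" by simp
  hence "norm ((of_nat (Suc \<nu>) :: complex) powr (- s)) = real (Suc \<nu>) powr (- Re s)"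
    by (simp add: norm_powr_real_powr del: of_nat_Suc)
  thus ?thesis using cond_c1_nonneg[OF assms] by (simp add: norm_mult del: of_nat_Suc)
qed

lemma dirichlet_sums:
  assumes "cond_c1 c" "cond_c2 c D lam_c" "Re s > 1"
  shows "(\<lambda>\<nu>. of_real (c (Suc \<nu>)) * of_nat (Suc \<nu>) powr (- s)) sums D s"
proof -
  have "summable (\<lambda>\<nu>. of_real (c (Suc \<nu>)) * of_nat (Suc \<nu>) powr (- s) :: complex)"
    by (rule summable_norm_cancel, unfold norm_dirichlet_term[OF assms(1)]) (rule summable_dirichlet[OF assms(1,3)])
  moreover have "D s = dirichlet_series c s" using assms by (simp add: cond_c2_def)
  ultimately show ?thesis by (simp add: dirichlet_series_def summable_sums)
qed

lemma vertically_moderate_dirichlet: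
  assumes c1: "cond_c1 c" and c2: "cond_c2 c D lam_c"
  shows "vertically_moderate D"
  unfolding vertically_moderate_def
proof (intro conjI allI impI)
  from c2 obtain \<eta> where \<eta>: "\<eta> > 0" "D analytic_on ({s. Re s \<ge> 1 - \<eta> / ln (3 + \<bar>Im s\<bar>)} - {1})"
    unfolding cond_c2_def by blast
  have "{s. Re s > 1} \<subseteq> {s. Re s \<ge> 1 - \<eta> / ln (3 + \<bar>Im s\<bar>)} - {1}"
  proof
    fix s :: complex assume s: "s \<in> {s. Re s > 1}"
    have "\<eta> / ln (3 + \<bar>Im s\<bar>) \<ge> 0" using \<eta> by (intro divide_nonneg_nonneg ln_ge_zero) auto
    thus "s \<in> {s. Re s \<ge> 1 - \<eta> / ln (3 + \<bar>Im s\<bar>)} - {1}" using s by auto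
  qed
  thus "D holomorphic_on {s. Re s > 1}"
    using \<eta>(2) by (meson analytic_imp_holomorphic analytic_on_subset)
  fix a b :: real assume ab: "1 < a" "a \<le> b"
  define K where "K = (\<Sum>\<nu>. c (Suc \<nu>) * real (Suc \<nu>) powr (- a))"
  have "norm (D (Complex \<sigma> t)) \<le> K * (1 + \<bar>t\<bar>) ^ 0" if "a \<le> \<sigma>" for \<sigma> t
  proof -
    have s: "Re (Complex \<sigma> t) > 1" using that ab by simp
    have "norm (D (Complex \<sigma> t)) \<le> K"
      unfolding K_def using dirichlet_sums[OF c1 c2 s] summable_dirichlet[OF c1 ab(1)]
    proof (rule norm_sums_le[OF _ summable_sums])
      fix \<nu>
      have "c (Suc \<nu>) * real (Suc \<nu>) powr (- \<sigma>) \<le> c (Suc \<nu>) * real (Suc \<nu>) powr (- a)"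
        using that cond_c1_nonneg[OF c1] by (intro mult_left_mono powr_mono) auto
      thus "norm (of_real (c (Suc \<nu>)) * of_nat (Suc \<nu>) powr (- Complex \<sigma> t) :: complex) \<le> c (Suc \<nu>) * real (Suc \<nu>) powr (- a)"
        unfolding norm_dirichlet_term[OF c1] by simp
    qed
    thus ?thesis by simp
  qed
  thus "\<exists>K m. \<forall>\<sigma> t. a \<le> \<sigma> \<longrightarrow> \<sigma> \<le> b \<longrightarrow> norm (D (Complex \<sigma> t)) \<le> K * (1 + \<bar>t\<bar>) ^ m"
    by blast
qed

lemma kappa_alt:
  assumes "y > 0"
  shows "kappa G a y = 1 / (2 * of_real pi) * (LINT t|lborel. G (Complex a t) * exp (- Complex a t * of_real (ln y)))"
  using assms by (simp add: kappa_def of_real_powr_exp)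

text \<open>
Sum and integral may be interchanged because on \<open>Re s = a > 1\<close> the Dirichlet series converges
absolutely and \<open>\<gamma>\<close> is integrable.
\<close>

lemma kappa_dirichlet_sums:
  assumes c1: "cond_c1 c" and c2: "cond_c2 c D lam_c" and \<gamma>: "vertically_rapid \<gamma>" and a: "1 < a" and y: "y > 0"
  shows "(\<lambda>\<nu>. of_real (c (Suc \<nu>)) * kappa \<gamma> a (real (Suc \<nu>) * y)) sums kappa (\<lambda>s. \<gamma> s * D s) a y"
proof -
  define u where "u t = \<gamma> (Complex a t) * exp (- Complex a t * of_real (ln y))" for t
  define f where "f \<nu> t = of_real (c (Suc \<nu>)) * of_nat (Suc \<nu>) powr (- Complex a t) * u t" for \<nu> t
  have u: "integrable lborel u"
    unfolding u_def using vertically_rapid_integrable[OF \<gamma> a] affine_along_line[where c = "-1" and a = a and d = 0]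
    by (intro integrable_mult_exp_line[where \<rho> = "-a"]) auto
  have Re: "Re (Complex a t) > 1" for t using a by simp
  have fn: "norm (f \<nu> t) = c (Suc \<nu>) * real (Suc \<nu>) powr (- a) * norm (u t)" for \<nu> t
    unfolding f_def norm_mult[of _ "u t"] norm_dirichlet_term[OF c1] by simp
  have fexp: "f \<nu> t = of_real (c (Suc \<nu>)) * (\<gamma> (Complex a t) * exp (- Complex a t * of_real (ln (real (Suc \<nu>) * y))))" for \<nu> t
  proof -
    have "(of_nat (Suc \<nu>) :: complex) powr (- Complex a t) = exp (- Complex a t * of_real (ln (real (Suc \<nu>))))"
      using of_real_powr_exp[of "real (Suc \<nu>)" "- Complex a t"] by simp
    moreover have "exp (- Complex a t * of_real (ln (real (Suc \<nu>) * y)))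
        = exp (- Complex a t * of_real (ln (real (Suc \<nu>)))) * exp (- Complex a t * of_real (ln y))"
    proof -
      have "ln (real (Suc \<nu>) * y) = ln (real (Suc \<nu>)) + ln y"
        using y by (simp add: ln_mult del: of_nat_Suc)
      thus ?thesis by (simp only: of_real_add distrib_left exp_add)
    qed
    ultimately show ?thesis
      by (simp only: f_def u_def mult_ac)
  qed
  have intf: "integrable lborel (f \<nu>)" for \<nu>
    unfolding fexp[abs_def] using vertically_rapid_integrable[OF \<gamma> a] affine_along_line[where c = "-1" and a = a and d = 0]
    by (intro integrable_mult_right integrable_mult_exp_line[where \<rho> = "-a"]) auto
  have "(\<lambda>\<nu>. integral\<^sup>L lborel (f \<nu>)) sums (LINT t|lborel. (\<Sum>\<nu>. f \<nu> t))"
  proof (rule sums_integral[OF intf])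
    show "AE t in lborel. summable (\<lambda>\<nu>. norm (f \<nu> t))"
      unfolding fn by (intro AE_I2 summable_mult2 summable_dirichlet[OF c1 a])
    show "summable (\<lambda>\<nu>. LINT t|lborel. norm (f \<nu> t))"
      unfolding fn integral_mult_right_zero by (intro summable_mult2 summable_dirichlet[OF c1 a])
  qed
  also have "(\<lambda>t. \<Sum>\<nu>. f \<nu> t) = (\<lambda>t. \<gamma> (Complex a t) * D (Complex a t) * exp (- Complex a t * of_real (ln y)))"
  proof
    fix t
    have "(\<lambda>\<nu>. f \<nu> t) sums (D (Complex a t) * u t)"
      unfolding f_def by (rule sums_mult2[OF dirichlet_sums[OF c1 c2 Re]])
    thus "(\<Sum>\<nu>. f \<nu> t) = \<gamma> (Complex a t) * D (Complex a t) * exp (- Complex a t * of_real (ln y))"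
      by (simp add: sums_iff u_def mult_ac)
  qed
  finally have "(\<lambda>\<nu>. 1 / (2 * of_real pi) * integral\<^sup>L lborel (f \<nu>)) sums
      (1 / (2 * of_real pi) * (LINT t|lborel. \<gamma> (Complex a t) * D (Complex a t) * exp (- Complex a t * of_real (ln y))))"
    by (rule sums_mult)
  also have "(1 / (2 * of_real pi) * (LINT t|lborel. \<gamma> (Complex a t) * D (Complex a t) * exp (- Complex a t * of_real (ln y))))
      = kappa (\<lambda>s. \<gamma> s * D s) a y"
    by (rule kappa_alt[OF y, symmetric])
  also have "(\<lambda>\<nu>. 1 / (2 * of_real pi) * integral\<^sup>L lborel (f \<nu>))
      = (\<lambda>\<nu>. of_real (c (Suc \<nu>)) * kappa \<gamma> a (real (Suc \<nu>) * y))"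
  proof
    fix \<nu>
    have "real (Suc \<nu>) * y > 0" using y by simp
    from kappa_alt[OF this, of \<gamma> a]
    show "1 / (2 * of_real pi) * integral\<^sup>L lborel (f \<nu>) = of_real (c (Suc \<nu>)) * kappa \<gamma> a (real (Suc \<nu>) * y)"
      unfolding fexp[abs_def] integral_mult_right_zero by simp
  qed
  finally show ?thesis .
qed

lemma h_fun_vertical_transform:
  assumes c1: "cond_c1 c" and c2: "cond_c2 c D lam_c" and \<gamma>: "vertically_rapid \<gamma>" and a: "1 < a" and x: "x > 0"
  shows "h_fun c \<gamma> a \<epsilon> n x = vertical_transform (\<lambda>s. \<gamma> s * D s) (real n) 0 a x
           - of_real \<epsilon> * vertical_transform (\<lambda>s. \<gamma> s * D s) (- real n) (real n) a x"
proof -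
  let ?G = "\<lambda>s. \<gamma> s * D s"
  have xn: "x ^ n > 0" "1 / x ^ n > 0" using x by auto
  have e1: "kappa ?G a (1 / x ^ n) = vertical_transform ?G (real n) 0 a x"
    unfolding kappa_alt[OF xn(2)] vertical_transform_def line_integral_def
    using x by (simp add: ln_div ln_realpow mult_ac)
  have xn': "of_real (x ^ n) = exp (of_real (real n) * of_real (ln x) :: complex)"
    by (simp only: of_real_of_nat_eq exp_of_nat_mult exp_of_real exp_ln[OF x] of_real_power)
  have ex: "exp (of_real (real n) * of_real (ln x)) * (g * exp (- w * of_real (ln (x ^ n))))
     = g * exp ((of_real (- real n) * w + of_real (real n)) * of_real (ln x))" for g w :: complex
  proof -
    have "(of_real (- real n) * w + of_real (real n)) * of_real (ln x)
        = of_real (real n) * of_real (ln x) + - w * of_real (ln (x ^ n))"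
      using x by (simp add: ln_realpow algebra_simps)
    thus ?thesis by (simp only: exp_add mult_ac)
  qed
  have e2: "of_real (x ^ n) * kappa ?G a (x ^ n) = vertical_transform ?G (- real n) (real n) a x"
  proof -
    have "of_real (x ^ n) * (LINT t|lborel. ?G (Complex a t) * exp (- Complex a t * of_real (ln (x ^ n))))
        = (LINT t|lborel. ?G (Complex a t) * exp ((of_real (- real n) * Complex a t + of_real (real n)) * of_real (ln x)))"
      unfolding integral_mult_right_zero[symmetric] xn' ex ..
    thus ?thesis
      unfolding kappa_alt[OF xn(1)] vertical_transform_def line_integral_def
      by (subst mult.left_commute) (simp only:)
  qed
  have "(\<lambda>\<nu>. of_real (c (Suc \<nu>)) * kappa \<gamma> a (real (Suc \<nu>) * (1 / x ^ n))
           - of_real \<epsilon> * of_real (x ^ n) * (of_real (c (Suc \<nu>)) * kappa \<gamma> a (real (Suc \<nu>) * x ^ n)))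
        sums (kappa ?G a (1 / x ^ n) - of_real \<epsilon> * of_real (x ^ n) * kappa ?G a (x ^ n))"
    by (intro sums_diff sums_mult kappa_dirichlet_sums[OF c1 c2 \<gamma> a] xn)
  also have "(\<lambda>\<nu>. of_real (c (Suc \<nu>)) * kappa \<gamma> a (real (Suc \<nu>) * (1 / x ^ n))
           - of_real \<epsilon> * of_real (x ^ n) * (of_real (c (Suc \<nu>)) * kappa \<gamma> a (real (Suc \<nu>) * x ^ n)))
      = (\<lambda>\<nu>. of_real (c (Suc \<nu>)) * V_fun \<gamma> a \<epsilon> n x (Suc \<nu>))"
    by (simp add: V_fun_def algebra_simps)
  finally have "h_fun c \<gamma> a \<epsilon> n x = kappa ?G a (1 / x ^ n) - of_real \<epsilon> * (of_real (x ^ n) * kappa ?G a (x ^ n))"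
    by (simp add: h_fun_def sums_iff)
  thus ?thesis by (simp only: e1 e2)
qed

section \<open>Landau's theorem and continuation\<close>

text \<open>
\<open>Landau_laplace\<close> applies to the part of the density near \<open>0\<close>, where \<open>Z\<close> has a sign \<open>\<tau>\<close>. The rest
lives on some \<open>[u, 1)\<close> with \<open>u > 0\<close>, where powers of \<open>x\<close> are bounded above and below, so its
transform is holomorphic wherever it is needed and can be subtracted from \<open>g\<close>.
\<close>

lemma Landau_mellin:
  assumes y: "y > 0" and sgn: "single_sign_on Z {0<..<y}"
    and conv: "\<And>\<sigma>. \<sigma> > \<sigma>\<^sub>1 \<Longrightarrow> mellin_integrable Z (of_real \<sigma>)"
    and \<rho>: "\<rho> > 0" and g: "g holomorphic_on ball (of_real \<sigma>\<^sub>1) \<rho>"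
    and eq: "\<And>z. z \<in> ball (of_real \<sigma>\<^sub>1) \<rho> \<Longrightarrow> Re z > \<sigma>\<^sub>1 \<Longrightarrow> g z = mellin Z z"
  shows "\<exists>\<sigma><\<sigma>\<^sub>1. mellin_integrable Z (of_real \<sigma>)"
proof -
  define u where "u = min y (1 / 2)"
  have u: "0 < u" "u < 1" "u \<le> y" using y by (auto simp: u_def)
  let ?f = "mellin_density Z"
  define p where "p x = indicator {0<..<u} x * norm (?f x)" for x
  define f2 where "f2 x = indicator {u..<1} x *\<^sub>R ?f x" for x
  have conv1: "mellin_integrable Z (of_real (\<sigma>\<^sub>1 + 1))" by (rule conv) simp
  note m[measurable] = mellin_density_measurable[OF conv1]
  have [measurable]: "p \<in> borel_measurable lborel" "f2 \<in> borel_measurable lborel"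
    unfolding p_def[abs_def] f2_def[abs_def] by measurable
  have iff: "mellin_integrable Z (of_real \<sigma>) \<longleftrightarrow> integrable lborel (\<lambda>x. norm (?f x) * exp (\<sigma> * ln x))" for \<sigma>
    using mellin_integrable_iff_norm[OF m, of "of_real \<sigma>"] by simp
  obtain \<tau> :: real where \<tau>: "\<tau> * \<tau> = 1" "\<And>x. 0 < x \<Longrightarrow> x < u \<Longrightarrow> Z x = of_real (\<tau> * norm (Z x))"
  proof -
    from sgn consider "\<forall>x\<in>{0<..<y}. Z x \<in> \<real> \<and> Re (Z x) \<ge> 0" | "\<forall>x\<in>{0<..<y}. Z x \<in> \<real> \<and> Re (Z x) \<le> 0"
      unfolding single_sign_on_def by blast
    thus ?thesis
    proof cases
      case 1
      have "Z x = of_real (1 * norm (Z x))" if "0 < x" "x < u" for x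
      proof -
        have "Z x \<in> \<real>" "Re (Z x) \<ge> 0" using 1 that u by auto
        thus ?thesis by (auto elim!: Reals_cases)
      qed
      thus ?thesis by (intro that[of 1]) auto
    next
      case 2
      have "Z x = of_real (-1 * norm (Z x))" if "0 < x" "x < u" for x
      proof -
        have "Z x \<in> \<real>" "Re (Z x) \<le> 0" using 2 that u by auto
        thus ?thesis by (auto elim!: Reals_cases)
      qed
      thus ?thesis by (intro that[of "-1"]) auto
    qed
  qed
  have split: "?f x = of_real \<tau> * of_real (p x) + f2 x" for x
  proof (cases "0 < x \<and> x < u")
    case True
    hence "?f x = Z x / of_real x" "p x = norm (Z x) / x" "f2 x = 0"
      using u by (auto simp: mellin_density_def p_def f2_def norm_divide)
    thus ?thesis using \<tau>(2)[of x] True by simp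
  next
    case False
    thus ?thesis using u by (auto simp: mellin_density_def p_def f2_def indicator_def)
  qed
  have nsplit: "norm (?f x) = p x + norm (f2 x)" for x
    using u by (auto simp: mellin_density_def p_def f2_def indicator_def)
  have int_p: "integrable lborel (\<lambda>x. p x * exp (\<sigma> * ln x))" if "\<sigma> > \<sigma>\<^sub>1" for \<sigma>
  proof (rule Bochner_Integration.integrable_bound)
    show "integrable lborel (\<lambda>x. norm (?f x) * exp (\<sigma> * ln x))" using conv[OF that] iff by blast
  qed (auto simp: p_def indicator_def intro!: AE_I2)
  have int_f2: "integrable lborel (\<lambda>x. norm (f2 x) * exp (\<sigma> * ln x))" for \<sigma>
  proof (rule Bochner_Integration.integrable_bound)
    show "integrable lborel (\<lambda>x. exp (\<bar>\<sigma> - (\<sigma>\<^sub>1 + 1)\<bar> * - ln u) * (norm (?f x) * exp ((\<sigma>\<^sub>1 + 1) * ln x)))"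
      using conv1 iff by (intro integrable_mult_right) blast
    show "AE x in lborel. norm (norm (f2 x) * exp (\<sigma> * ln x))
        \<le> norm (exp (\<bar>\<sigma> - (\<sigma>\<^sub>1 + 1)\<bar> * - ln u) * (norm (?f x) * exp ((\<sigma>\<^sub>1 + 1) * ln x)))"
    proof (intro AE_I2)
      fix x :: real
      show "norm (norm (f2 x) * exp (\<sigma> * ln x))
        \<le> norm (exp (\<bar>\<sigma> - (\<sigma>\<^sub>1 + 1)\<bar> * - ln u) * (norm (?f x) * exp ((\<sigma>\<^sub>1 + 1) * ln x)))"
      proof (cases "u \<le> x \<and> x < 1")
        case True
        hence l: "ln u \<le> ln x" "ln x \<le> 0" using u by auto
        have "(\<sigma> - (\<sigma>\<^sub>1 + 1)) * ln x \<le> \<bar>\<sigma> - (\<sigma>\<^sub>1 + 1)\<bar> * \<bar>ln x\<bar>"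
          by (metis abs_ge_self abs_mult)
        also have "\<dots> \<le> \<bar>\<sigma> - (\<sigma>\<^sub>1 + 1)\<bar> * - ln u"
          using l by (intro mult_left_mono) auto
        finally have "exp (\<sigma> * ln x) \<le> exp (\<bar>\<sigma> - (\<sigma>\<^sub>1 + 1)\<bar> * - ln u) * exp ((\<sigma>\<^sub>1 + 1) * ln x)"
          by (simp add: exp_add[symmetric] algebra_simps)
        from mult_left_mono[OF this norm_ge_zero[of "?f x"]] True show ?thesis
          by (simp add: f2_def mult_ac)
      qed (auto simp: f2_def)
    qed
  qed measurable
  define R where "R z = (LINT x|lborel. f2 x * exp (of_real (ln x) * z))" for z
  have R: "R holomorphic_on {z. Re z > \<sigma>\<^sub>1 - \<rho>}"
    unfolding R_def by (rule laplace_holomorphic) (use int_f2 in auto)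
  have sub: "ball (of_real \<sigma>\<^sub>1) \<rho> \<subseteq> {z. Re z > \<sigma>\<^sub>1 - \<rho>}"
  proof
    fix z :: complex assume "z \<in> ball (of_real \<sigma>\<^sub>1) \<rho>"
    thus "z \<in> {z. Re z > \<sigma>\<^sub>1 - \<rho>}"
      using abs_Re_le_cmod[of "of_real \<sigma>\<^sub>1 - z"] by (auto simp: dist_norm)
  qed
  have "\<exists>\<sigma><\<sigma>\<^sub>1. integrable lborel (\<lambda>x. p x * exp (\<sigma> * ln x))"
  proof (rule Landau_laplace[OF _ _ _ _ int_p \<rho>])
    show "(\<lambda>z. of_real \<tau> * (g z - R z)) holomorphic_on ball (of_real \<sigma>\<^sub>1) \<rho>"
      using R sub by (intro holomorphic_intros g) (auto intro: holomorphic_on_subset)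
    fix z assume z: "z \<in> ball (of_real \<sigma>\<^sub>1) \<rho>" "Re z > \<sigma>\<^sub>1"
    have i1: "integrable lborel (\<lambda>x. of_real (p x) * exp (of_real (ln x) * z))"
    proof -
      have "integrable lborel (\<lambda>x. norm (of_real (p x) * exp (of_real (ln x) * z) :: complex))"
        using int_p[OF z(2)] by (simp add: norm_mult p_def mult.commute[of "Re z"] abs_mult)
      thus ?thesis by (subst (asm) integrable_norm_iff) auto
    qed
    have i2: "integrable lborel (\<lambda>x. f2 x * exp (of_real (ln x) * z))"
    proof -
      have "integrable lborel (\<lambda>x. norm (f2 x * exp (of_real (ln x) * z)))"
        using int_f2[of "Re z"] by (simp add: norm_mult mult.commute[of "Re z"])
      thus ?thesis by (subst (asm) integrable_norm_iff) auto
    qed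
    have "g z = (LINT x|lborel. of_real \<tau> * (of_real (p x) * exp (of_real (ln x) * z)) + f2 x * exp (of_real (ln x) * z))"
      unfolding eq[OF z] mellin_def split by (simp add: algebra_simps)
    also have "\<dots> = of_real \<tau> * (LINT x|lborel. of_real (p x) * exp (of_real (ln x) * z)) + R z"
      using i1 i2 unfolding R_def by (subst Bochner_Integration.integral_add) (auto intro: integrable_mult_right)
    finally show "of_real \<tau> * (g z - R z) = (LINT x|lborel. of_real (p x) * exp (of_real (ln x) * z))"
      using \<tau>(1) by (simp add: mult.assoc[symmetric] flip: of_real_mult)
  next
    fix x assume "p x \<noteq> 0"
    thus "ln x \<le> 0" using u by (auto simp: p_def indicator_def split: if_splits)
  qed (auto simp: p_def)
  then obtain \<sigma> where \<sigma>: "\<sigma> < \<sigma>\<^sub>1" "integrable lborel (\<lambda>x. p x * exp (\<sigma> * ln x))"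
    by blast
  have "integrable lborel (\<lambda>x. norm (?f x) * exp (\<sigma> * ln x))"
    unfolding nsplit ring_distribs by (intro Bochner_Integration.integrable_add \<sigma> int_f2)
  with \<sigma>(1) iff show ?thesis by blast
qed

lemma eventually_eq_imp_eq_at:
  fixes f g :: "complex \<Rightarrow> complex"
  assumes "eventually (\<lambda>w. f w = g w) (at z)" "isCont f z" "isCont g z"
  shows "f z = g z"
proof (rule tendsto_unique[of "at z"])
  show "f \<midarrow>z\<rightarrow> f z" using assms by (simp add: isCont_def)
  show "f \<midarrow>z\<rightarrow> g z"
    using assms(3) eventually_mono[OF assms(1) sym] unfolding isCont_def by (rule Lim_transform_eventually)
qed simp

lemma holomorphic_isCont:
  "f holomorphic_on A \<Longrightarrow> open A \<Longrightarrow> z \<in> A \<Longrightarrow> isCont f z"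
  by (meson continuous_on_eq_continuous_at holomorphic_on_imp_continuous_on)

text \<open>
The difference of the two sides is meromorphic on a connected set, so it vanishes either
almost everywhere or almost nowhere. The equation can hold only up to isolated points because a
meromorphic function may take arbitrary values at its singularities.
\<close>

lemma meromorphic_half_plane_identity:
  assumes F: "F meromorphic_on {s. Re s > \<sigma>'}" and \<Phi>: "\<Phi> holomorphic_on {s. Re s > \<sigma>'}" and q: "\<sigma>' < q"
    and eq: "\<And>s. Re s > q \<Longrightarrow> (s - of_real q) ^ k * F s = \<Phi> s" and z: "Re z > \<sigma>'"
  shows "eventually (\<lambda>w. (w - of_real q) ^ k * F w = \<Phi> w) (at z)"
proof -
  let ?A = "{s. Re s > \<sigma>'}"
  let ?H = "\<lambda>w. (w - of_real q) ^ k * F w - \<Phi> w"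
  have "\<Phi> meromorphic_on ?A"
    using \<Phi> open_Re_gt by (intro analytic_on_imp_meromorphic_on) (simp add: analytic_on_open)
  hence "?H meromorphic_on ?A"
    using F by (intro meromorphic_intros) auto
  from meromorphic_imp_constant_or_avoid[OF this open_Re_gt convex_connected[OF convex_halfspace_Re_gt], of 0]
  consider "\<forall>z\<in>?A. eventually (\<lambda>w. ?H w = 0) (at z)" | "\<forall>z\<in>?A. eventually (\<lambda>w. ?H w \<noteq> 0) (at z)"
    using open_Re_gt by (auto simp: eventually_cosparse_open_eq)
  thus ?thesis
  proof cases
    case 1
    thus ?thesis using z by simp
  next
    case 2
    have "eventually (\<lambda>w. w \<in> {s. Re s > q}) (at (of_real (q + 1)))"
      by (intro eventually_at_in_open' open_Re_gt) auto
    moreover have "eventually (\<lambda>w. ?H w \<noteq> 0) (at (of_real (q + 1)))"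
      using 2 q by auto
    ultimately have "eventually (\<lambda>w. False) (at (complex_of_real (q + 1)))"
      by eventually_elim (use eq in auto)
    thus ?thesis by simp
  qed
qed

lemma not_pole_imp_holomorphic_extension:
  assumes "F meromorphic_on {z}" "\<not> is_pole F z"
  obtains \<rho> R where "\<rho> > 0" "R holomorphic_on ball z \<rho>" "\<And>w. w \<in> ball z \<rho> - {z} \<Longrightarrow> R w = F w"
proof -
  have iso: "isolated_singularity_at F z" and ne: "not_essential F z"
    using assms(1) by (auto simp: meromorphic_at_iff)
  then obtain L where L: "F \<midarrow>z\<rightarrow> L"
    using assms(2) by (auto simp: not_essential_def)
  from remove_sings_analytic_at[OF iso L] obtain r1 where r1: "r1 > 0" "remove_sings F holomorphic_on ball z r1"
    unfolding analytic_on_def by auto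
  from eventually_remove_sings_eq_at[OF iso] obtain r2 where r2: "r2 > 0"
    "\<And>w. w \<noteq> z \<Longrightarrow> dist w z < r2 \<Longrightarrow> remove_sings F w = F w"
    unfolding eventually_at by auto
  show ?thesis
  proof (rule that[of "min r1 r2" "remove_sings F"])
    show "remove_sings F holomorphic_on ball z (min r1 r2)"
      by (rule holomorphic_on_subset[OF r1(2)]) auto
  qed (use r1 r2 in \<open>auto simp: dist_commute\<close>)
qed

text \<open>
The analytic core, with \<open>q\<close> in the role of \<open>n\<close>. Its hypotheses say that \<open>(s - q)^k \<omega>(s)\<close> is, up to an
entire function, the Mellin transform of \<open>Z\<close>, and that it extends around \<open>q\<close> with a nonzero value.
Both conclusions use the same step: at a real point around which the transform of \<open>Z\<close> continues
holomorphically, convergence to the right of the point implies convergence a little to the left.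
\<close>

lemma Landau_continuation:
  fixes q :: real and k :: nat
  assumes y: "y > 0" and sgn: "single_sign_on Z {0<..<y}"
    and conv: "\<And>\<sigma>. \<sigma> > 0 \<Longrightarrow> mellin_integrable Z (of_real \<sigma>)"
    and P: "P holomorphic_on UNIV"
    and \<omega>: "\<And>s. Re s > q \<Longrightarrow> (s - of_real q) ^ k * \<omega> s = mellin Z (s - of_real q) + P s"
    and r: "r > 0" and N: "N holomorphic_on ball (of_real q) r" "N (of_real q) \<noteq> 0"
    and N_eq: "\<And>s. s \<in> ball (of_real q) r \<Longrightarrow> Re s > q \<Longrightarrow> (s - of_real q) ^ k * \<omega> s = N s"
    and k: "k > 0"
  shows "\<exists>\<delta>>0. \<exists>F. F holomorphic_on ({s. Re s > q - \<delta>} - {of_real q}) \<and>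
            (\<forall>s. Re s > q \<longrightarrow> F s = \<omega> s) \<and> is_pole F (of_real q)" (is ?A)
    and "\<And>\<sigma>\<^sub>0 F s. \<sigma>\<^sub>0 < q \<Longrightarrow> F meromorphic_on {s. Re s > \<sigma>\<^sub>0} \<Longrightarrow>
            (\<And>s. Re s > q \<Longrightarrow> F s = \<omega> s) \<Longrightarrow>
            (\<And>\<sigma>. \<sigma>\<^sub>0 < \<sigma> \<Longrightarrow> \<sigma> < q \<Longrightarrow> \<not> is_pole F (of_real \<sigma>)) \<Longrightarrow>
            \<sigma>\<^sub>0 < Re s \<Longrightarrow> Re s < q \<Longrightarrow> \<not> is_pole F s"
proof -
  define \<Phi> where "\<Phi> s = mellin Z (s - of_real q) + P s" for s
  have hol_shift: "(\<lambda>s. f (s + c)) holomorphic_on B" if "f holomorphic_on A" "(\<lambda>s. s + c) ` B \<subseteq> A" for f c A B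
  proof -
    have "(\<lambda>s. s + c) holomorphic_on B" by (intro holomorphic_intros)
    from holomorphic_on_compose_gen[OF this that] show ?thesis by (simp add: o_def)
  qed
  have \<Phi>_hol: "\<Phi> holomorphic_on {s. Re s > \<tau>}" if "\<And>\<sigma>. \<sigma> > \<tau> \<Longrightarrow> mellin_integrable Z (of_real (\<sigma> - q))" for \<tau>
  proof -
    have "mellin Z holomorphic_on {z. Re z > \<tau> - q}"
    proof (rule mellin_holomorphic)
      fix \<sigma> assume "\<sigma> > \<tau> - q"
      thus "mellin_integrable Z (of_real \<sigma>)" using that[of "\<sigma> + q"] by simp
    qed
    hence "(\<lambda>s. mellin Z (s + - of_real q)) holomorphic_on {s. Re s > \<tau>}"
      by (rule hol_shift) auto
    thus ?thesis
      unfolding \<Phi>_def[abs_def] using P by (auto intro!: holomorphic_intros intro: holomorphic_on_subset)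
  qed
  have up: "mellin_integrable Z (of_real (\<sigma>' - q))" if "mellin_integrable Z (of_real (\<sigma> - q))" "\<sigma> \<le> \<sigma>'" for \<sigma> \<sigma>'
    using that by (intro mellin_integrable_mono[OF that(1)]) auto
  \<comment> \<open>Landau's theorem in the variable \<open>s = z + q\<close>, with the entire part added to the transform.\<close>
  have step: "\<exists>\<sigma><\<tau>. mellin_integrable Z (of_real (\<sigma> - q))"
    if conv\<tau>: "\<And>\<sigma>. \<sigma> > \<tau> \<Longrightarrow> mellin_integrable Z (of_real (\<sigma> - q))"
      and \<rho>: "\<rho> > 0" and g: "g holomorphic_on ball (of_real \<tau>) \<rho>"
      and g_eq: "\<And>s. s \<in> ball (of_real \<tau>) \<rho> \<Longrightarrow> Re s > \<tau> \<Longrightarrow> g s = \<Phi> s" for \<tau> \<rho> g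
  proof -
    have "\<exists>\<sigma><\<tau> - q. mellin_integrable Z (of_real \<sigma>)"
    proof (rule Landau_mellin[OF y sgn _ \<rho>])
      show "mellin_integrable Z (of_real \<sigma>)" if "\<sigma> > \<tau> - q" for \<sigma>
        using conv\<tau>[of "\<sigma> + q"] that by simp
      have "(\<lambda>s. g s - P s) holomorphic_on ball (of_real \<tau>) \<rho>"
        using g P by (auto intro!: holomorphic_intros intro: holomorphic_on_subset)
      thus "(\<lambda>z. g (z + of_real q) - P (z + of_real q)) holomorphic_on ball (of_real (\<tau> - q)) \<rho>"
        by (rule hol_shift) (auto simp: dist_norm algebra_simps)
      show "g (z + of_real q) - P (z + of_real q) = mellin Z z"
        if "z \<in> ball (of_real (\<tau> - q)) \<rho>" "Re z > \<tau> - q" for z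
        using g_eq[of "z + of_real q"] that by (simp add: \<Phi>_def dist_norm algebra_simps)
    qed
    then obtain \<sigma> where "\<sigma> < \<tau> - q" "mellin_integrable Z (of_real \<sigma>)" by blast
    thus ?thesis by (intro exI[of _ "\<sigma> + q"]) auto
  qed
  have "\<exists>\<sigma><q. mellin_integrable Z (of_real (\<sigma> - q))"
  proof (rule step[OF _ r N(1)])
    show "mellin_integrable Z (of_real (\<sigma> - q))" if "\<sigma> > q" for \<sigma>
      using that by (intro conv) simp
    show "N s = \<Phi> s" if "s \<in> ball (of_real q) r" "Re s > q" for s
      using N_eq[OF that] \<omega>[OF that(2)] by (simp add: \<Phi>_def)
  qed
  then obtain \<sigma>\<^sub>c where \<sigma>\<^sub>c: "\<sigma>\<^sub>c < q" "mellin_integrable Z (of_real (\<sigma>\<^sub>c - q))" by blast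
  show ?A
  proof (intro exI conjI allI impI)
    let ?F = "\<lambda>s. \<Phi> s / (s - of_real q) ^ k"
    have \<Phi>: "\<Phi> holomorphic_on {s. Re s > \<sigma>\<^sub>c}"
      by (rule \<Phi>_hol, rule up[OF \<sigma>\<^sub>c(2)]) simp
    show "q - \<sigma>\<^sub>c > 0" using \<sigma>\<^sub>c by simp
    show "?F holomorphic_on {s. Re s > q - (q - \<sigma>\<^sub>c)} - {of_real q}"
      using \<Phi> by (auto intro!: holomorphic_intros intro: holomorphic_on_subset)
    show "?F s = \<omega> s" if "Re s > q" for s
    proof -
      have "s \<noteq> of_real q" using that by auto
      thus ?thesis using \<omega>[OF that] by (simp add: \<Phi>_def field_simps)
    qed
    \<comment> \<open>On this disc both \<open>\<Phi>\<close> and \<open>N\<close> are holomorphic, so their equality spreads from the right half to \<open>q\<close>.\<close>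
    define d where "d = min r (q - \<sigma>\<^sub>c)"
    have d: "d > 0" using r \<sigma>\<^sub>c by (simp add: d_def)
    have sub: "ball (of_real q) d \<subseteq> {s. Re s > \<sigma>\<^sub>c}"
    proof
      fix s :: complex assume "s \<in> ball (of_real q) d"
      thus "s \<in> {s. Re s > \<sigma>\<^sub>c}"
        using abs_Re_le_cmod[of "of_real q - s"] by (auto simp: dist_norm d_def)
    qed
    have "\<Phi> (of_real q) = N (of_real q)"
    proof (rule analytic_continuation_open[where f = \<Phi> and g = N])
      show "open (ball (of_real q) d \<inter> {s. Re s > q})" by (intro open_Int open_ball open_Re_gt)
      have "of_real (q + d / 2) \<in> ball (of_real q) d \<inter> {s. Re s > q}"
        using d by (auto simp: dist_norm)
      thus "ball (of_real q) d \<inter> {s. Re s > q} \<noteq> {}" by blast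
      show "\<Phi> holomorphic_on ball (of_real q) d" using \<Phi> sub by (rule holomorphic_on_subset)
      show "N holomorphic_on ball (of_real q) d" using N(1) by (rule holomorphic_on_subset) (auto simp: d_def)
      show "\<Phi> s = N s" if "s \<in> ball (of_real q) d \<inter> {s. Re s > q}" for s
        using that N_eq[of s] \<omega>[of s] by (auto simp: \<Phi>_def d_def)
    qed (use d in auto)
    hence nz: "\<Phi> (of_real q) \<noteq> 0" using N(2) by simp
    show "is_pole ?F (of_real q)"
    proof (rule is_pole_divide)
      show "isCont \<Phi> (of_real q)"
        by (rule holomorphic_isCont[OF \<Phi> open_Re_gt]) (use \<sigma>\<^sub>c in auto)
      show "filterlim (\<lambda>s. (s - of_real q) ^ k) (at 0) (at (complex_of_real q))"
      proof (rule filterlim_atI)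
        have "((\<lambda>s. (s - of_real q) ^ k) \<longlongrightarrow> (of_real q - of_real q) ^ k) (at (complex_of_real q))"
          by (intro tendsto_intros)
        thus "((\<lambda>s. (s - of_real q) ^ k) \<longlongrightarrow> 0) (at (complex_of_real q))"
          using k by (simp add: power_0_left)
        show "\<forall>\<^sub>F s in at (complex_of_real q). (s - of_real q) ^ k \<noteq> 0"
          unfolding eventually_at by (rule exI[of _ 1]) auto
      qed
    qed (rule nz)
  qed
  fix \<sigma>\<^sub>0 F s
  assume \<sigma>\<^sub>0: "\<sigma>\<^sub>0 < q" and F: "F meromorphic_on {s. Re s > \<sigma>\<^sub>0}"
    and F_eq: "\<And>s. Re s > q \<Longrightarrow> F s = \<omega> s"
    and no_pole: "\<And>\<sigma>. \<sigma>\<^sub>0 < \<sigma> \<Longrightarrow> \<sigma> < q \<Longrightarrow> \<not> is_pole F (of_real \<sigma>)"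
    and s: "\<sigma>\<^sub>0 < Re s" "Re s < q"
  have ident: "eventually (\<lambda>w. (w - of_real q) ^ k * F w = \<Phi> w) (at z)"
    if "\<tau> \<ge> \<sigma>\<^sub>0" "\<tau> < q" "\<And>\<sigma>. \<sigma> > \<tau> \<Longrightarrow> mellin_integrable Z (of_real (\<sigma> - q))" "Re z > \<tau>" for \<tau> z
  proof (rule meromorphic_half_plane_identity[OF _ \<Phi>_hol[OF that(3)] that(2) _ that(4)])
    show "F meromorphic_on {s. Re s > \<tau>}" using F by (rule meromorphic_on_subset) (use that in auto)
    show "(s - of_real q) ^ k * F s = \<Phi> s" if "Re s > q" for s
      using \<omega>[OF that] F_eq[OF that] by (simp add: \<Phi>_def)
  qed
  \<comment> \<open>If the integral diverged at some \<open>\<tau> > \<sigma>\<^sub>0\<close>, its abscissa \<open>Inf S\<close> would lie in \<open>(\<sigma>\<^sub>0, q)\<close>. There \<open>F\<close>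
    has no pole, so it continues the transform across the abscissa, against Landau's theorem.\<close>
  have all: "mellin_integrable Z (of_real (\<tau> - q))" if \<tau>: "\<tau> > \<sigma>\<^sub>0" for \<tau>
  proof (rule ccontr)
    assume neg: "\<not> mellin_integrable Z (of_real (\<tau> - q))"
    define S where "S = {\<sigma>. mellin_integrable Z (of_real (\<sigma> - q))}"
    have ge: "\<tau> \<le> \<sigma>" if "\<sigma> \<in> S" for \<sigma>
      using up[of \<sigma> \<tau>] neg that by (fastforce simp: S_def)
    have bdd: "bdd_below S" using ge by (auto intro!: bdd_belowI)
    have ne: "S \<noteq> {}" using \<sigma>\<^sub>c by (auto simp: S_def)
    have Inf_ge: "\<tau> \<le> Inf S" using ne ge by (rule cInf_greatest)
    have "Inf S \<le> \<sigma>\<^sub>c" by (rule cInf_lower[OF _ bdd]) (use \<sigma>\<^sub>c in \<open>simp add: S_def\<close>)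
    hence Inf_lt: "Inf S < q" using \<sigma>\<^sub>c by simp
    have convS: "mellin_integrable Z (of_real (\<sigma> - q))" if lt: "\<sigma> > Inf S" for \<sigma>
    proof -
      obtain \<sigma>' where "\<sigma>' \<in> S" "\<sigma>' < \<sigma>" using lt cInf_less_iff[OF ne bdd, of \<sigma>] by blast
      thus ?thesis using up[of \<sigma>' \<sigma>] by (simp add: S_def)
    qed
    have "F meromorphic_on {of_real (Inf S)}"
      by (rule meromorphic_on_subset[OF F]) (use Inf_ge \<tau> in auto)
    moreover have "\<not> is_pole F (of_real (Inf S))"
      using no_pole Inf_ge Inf_lt \<tau> by auto
    ultimately obtain \<rho> R where R: "\<rho> > 0" "R holomorphic_on ball (of_real (Inf S)) \<rho>"
      "\<And>w. w \<in> ball (of_real (Inf S)) \<rho> - {of_real (Inf S)} \<Longrightarrow> R w = F w"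
      by (rule not_pole_imp_holomorphic_extension) blast
    have "\<exists>\<sigma><Inf S. mellin_integrable Z (of_real (\<sigma> - q))"
    proof (rule step[OF convS R(1)])
      show hol: "(\<lambda>w. (w - of_real q) ^ k * R w) holomorphic_on ball (of_real (Inf S)) \<rho>"
        by (intro holomorphic_intros R)
      fix w assume w: "w \<in> ball (of_real (Inf S)) \<rho>" "Re w > Inf S"
      have "eventually (\<lambda>v. v \<in> ball (of_real (Inf S)) \<rho> \<inter> {v. Re v > Inf S}) (at w)"
        using w by (intro eventually_at_in_open' open_Int open_ball open_Re_gt) auto
      moreover have "eventually (\<lambda>v. (v - of_real q) ^ k * F v = \<Phi> v) (at w)"
        by (rule ident[of "Inf S"]) (use Inf_ge \<tau> Inf_lt convS w in auto)
      ultimately have "eventually (\<lambda>v. (v - of_real q) ^ k * R v = \<Phi> v) (at w)"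
      proof eventually_elim
        case (elim v)
        hence "R v = F v" by (intro R(3)) auto
        with elim show ?case by simp
      qed
      thus "(w - of_real q) ^ k * R w = \<Phi> w"
      proof (rule eventually_eq_imp_eq_at)
        show "isCont (\<lambda>w. (w - of_real q) ^ k * R w) w"
          by (rule holomorphic_isCont[OF hol open_ball w(1)])
        show "isCont \<Phi> w"
          by (rule holomorphic_isCont[OF \<Phi>_hol[OF convS] open_Re_gt]) (use w in auto)
      qed
    qed
    then obtain \<sigma> where "\<sigma> < Inf S" "\<sigma> \<in> S" by (auto simp: S_def)
    thus False using cInf_lower[OF _ bdd, of \<sigma>] by simp
  qed
  have ev: "eventually (\<lambda>w. (w - of_real q) ^ k * F w = \<Phi> w) (at s)"
    by (rule ident[of \<sigma>\<^sub>0]) (use \<sigma>\<^sub>0 all s in auto)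
  have sq: "s \<noteq> of_real q" using s by auto
  have "eventually (\<lambda>w. w \<in> - {of_real q}) (at s)"
    using sq by (intro eventually_at_in_open') auto
  with ev have ev': "eventually (\<lambda>w. \<Phi> w / (w - of_real q) ^ k = F w) (at s)"
    by eventually_elim (auto simp: field_simps)
  have cont: "isCont (\<lambda>w. \<Phi> w / (w - of_real q) ^ k) s"
  proof (rule isCont_divide)
    have "\<Phi> holomorphic_on {s. Re s > \<sigma>\<^sub>0}" by (rule \<Phi>_hol, rule all)
    thus "isCont \<Phi> s" by (rule holomorphic_isCont[OF _ open_Re_gt]) (use s in simp)
  qed (use sq in \<open>auto intro!: continuous_intros\<close>)
  have "F \<midarrow>s\<rightarrow> \<Phi> s / (s - of_real q) ^ k"
    using Lim_transform_eventually[OF cont[unfolded isCont_def] ev'] .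
  thus "\<not> is_pole F s"
    unfolding is_pole_def using not_tendsto_and_filterlim_at_infinity[of "at s"] by auto
qed

section \<open>Euler operator iterates and their Mellin transforms\<close>

text \<open>
The \<open>j\<close>-th iterate of \<open>- x d/dx\<close> on \<open>h\<close>: each application multiplies the two integrands by minus
their exponents \<open>n s\<close> and \<open>n - n s\<close>. The exponents are kept in the common affine form, zero
summand included, so that the results on \<open>vertical_transform\<close> apply verbatim.
\<close>

definition euler_iterate ::
  "(complex \<Rightarrow> complex) \<Rightarrow> real \<Rightarrow> real \<Rightarrow> nat \<Rightarrow> nat \<Rightarrow> real \<Rightarrow> complex" where
  "euler_iterate G a \<epsilon> n j x =
     vertical_transform (\<lambda>s. G s * (- (of_real (real n) * s + of_real 0)) ^ j) (real n) 0 a x -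
     of_real \<epsilon> * vertical_transform (\<lambda>s. G s * (- (of_real (- real n) * s + of_real (real n))) ^ j) (- real n) (real n) a x"

lemma vertically_rapid_mult_affine_power:
  assumes "vertically_rapid G"
  shows "vertically_rapid (\<lambda>s. G s * (- (of_real c * s + of_real d)) ^ j)"
proof (induction j)
  case (Suc j)
  have "vertically_rapid (\<lambda>s. G s * (- (of_real c * s + of_real d)) ^ j * (of_real (- c) * s + of_real (- d)))"
    by (intro vertically_rapid_mult_moderate Suc vertically_moderate_linear)
  thus ?case by (simp add: mult_ac)
qed (use assms in simp)

lemma neg_euler_op_euler_iterate:
  assumes G: "vertically_rapid G" and a: "a > 1" and x: "x > 0"
    and eq: "\<And>x. x > 0 \<Longrightarrow> f x = euler_iterate G a \<epsilon> n j x"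
  shows "neg_euler_op f x = euler_iterate G a \<epsilon> n (Suc j) x"
proof -
  let ?G1 = "\<lambda>j s. G s * (- (of_real (real n) * s + of_real 0)) ^ j"
  let ?G2 = "\<lambda>j s. G s * (- (of_real (- real n) * s + of_real (real n))) ^ j"
  have r1: "vertically_rapid (?G1 j)" and r2: "vertically_rapid (?G2 j)"
    by (rule vertically_rapid_mult_affine_power[OF G])+
  have pw: "u * z ^ j * z = u * z ^ Suc j" for u z :: complex by simp
  note D1 = vertical_transform_has_vector_derivative[OF r1 a x, of "real n" 0, unfolded pw]
  note D2 = vertical_transform_has_vector_derivative[OF r2 a x, of "- real n" "real n", unfolded pw]
  have "(euler_iterate G a \<epsilon> n j has_vector_derivative - (1 / x) *\<^sub>R euler_iterate G a \<epsilon> n (Suc j) x) (at x)"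
    unfolding euler_iterate_def[abs_def]
    by (rule has_vector_derivative_eq_rhs[OF has_vector_derivative_diff[OF D1 has_vector_derivative_mult_right[OF D2]]])
       (simp add: scaleR_conv_of_real algebra_simps del: power_Suc)
  hence "(f has_vector_derivative - (1 / x) *\<^sub>R euler_iterate G a \<epsilon> n (Suc j) x) (at x)"
    by (rule has_vector_derivative_transform_within_open[of _ _ _ "{0<..}"]) (use x eq in auto)
  thus ?thesis
    using x by (simp add: neg_euler_op_def vector_derivative_at)
qed

lemma neg_euler_op_power_euler_iterate:
  assumes "vertically_rapid G" "a > 1" "\<And>x. x > 0 \<Longrightarrow> f x = euler_iterate G a \<epsilon> n 0 x" "x > 0"
  shows "(neg_euler_op ^^ j) f x = euler_iterate G a \<epsilon> n j x"
  using assms(4)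
proof (induction j arbitrary: x)
  case (Suc j)
  show ?case
    using neg_euler_op_euler_iterate[OF assms(1,2) Suc.prems Suc.IH] by simp
qed (use assms in simp)

text \<open>
For \<open>Re z > 0\<close> there is a line to the right of \<open>1\<close> and to the left of \<open>1 + z/n\<close>; on it the second
part of \<open>h\<close> has a Mellin transform at \<open>z\<close>.
\<close>

lemma line_between_one_and_z:
  assumes "Re z > 0" "n > 0"
  defines "b \<equiv> 1 + Re z / (2 * real n)"
  shows "b > 1" "Re z + (- real n * b + real n) > 0"
  using assms by (auto simp: b_def field_simps)

lemma mellin_integrable_euler_iterate:
  assumes G: "vertically_rapid G" and a: "a > 1" and n: "n > 0" and z: "Re z > 0"
  shows "mellin_integrable (euler_iterate G a \<epsilon> n j) z"
    and "mellin (euler_iterate G a \<epsilon> n j) z =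
      mellin (vertical_transform (\<lambda>s. G s * (- (of_real (real n) * s + of_real 0)) ^ j) (real n) 0 a) z -
      of_real \<epsilon> * mellin (vertical_transform (\<lambda>s. G s * (- (of_real (- real n) * s + of_real (real n))) ^ j) (- real n) (real n) a) z"
    and "mellin (euler_iterate G a \<epsilon> n (Suc j)) z
       = z * mellin (euler_iterate G a \<epsilon> n j) z - euler_iterate G a \<epsilon> n j 1"
proof -
  note r = vertically_rapid_mult_affine_power[OF G]
  note b = line_between_one_and_z[OF z n]
  have z1: "Re z + (real n * a + 0) > 0" using z n a by (simp add: add_pos_pos)
  note i1 = vertical_transform_mellin(1)[OF r a a z1]
  note i2 = vertical_transform_mellin(1)[OF r a b]
  show "mellin_integrable (euler_iterate G a \<epsilon> n j) z"
    unfolding euler_iterate_def[abs_def] by (rule mellin_integrable_diff[OF i1 i2])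
  have diff: "mellin (euler_iterate G a \<epsilon> n j) z =
      mellin (vertical_transform (\<lambda>s. G s * (- (of_real (real n) * s + of_real 0)) ^ j) (real n) 0 a) z -
      of_real \<epsilon> * mellin (vertical_transform (\<lambda>s. G s * (- (of_real (- real n) * s + of_real (real n))) ^ j) (- real n) (real n) a) z" for j
    unfolding euler_iterate_def[abs_def] by (rule mellin_diff[OF i1 i2])
  thus "mellin (euler_iterate G a \<epsilon> n j) z =
      mellin (vertical_transform (\<lambda>s. G s * (- (of_real (real n) * s + of_real 0)) ^ j) (real n) 0 a) z -
      of_real \<epsilon> * mellin (vertical_transform (\<lambda>s. G s * (- (of_real (- real n) * s + of_real (real n))) ^ j) (- real n) (real n) a) z" .
  have pw: "u * w ^ j * w = u * w ^ Suc j" for u w :: complex and j by simp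
  define A where "A j = vertical_transform (\<lambda>s. G s * (- (of_real (real n) * s + of_real 0)) ^ j) (real n) 0 a" for j
  define B where "B j = vertical_transform (\<lambda>s. G s * (- (of_real (- real n) * s + of_real (real n))) ^ j) (- real n) (real n) a" for j
  have recA: "mellin (A (Suc j)) z = z * mellin (A j) z - A j 1"
    unfolding A_def by (rule mellin_vertical_transform_recurrence[OF r[where c = "real n" and d = 0] a a z1, unfolded pw])
  have recB: "mellin (B (Suc j)) z = z * mellin (B j) z - B j 1"
    unfolding B_def by (rule mellin_vertical_transform_recurrence[OF r[where c = "- real n" and d = "real n"] a b, unfolded pw])
  have at_1: "euler_iterate G a \<epsilon> n j 1 = A j 1 - of_real \<epsilon> * B j 1"
    by (simp only: euler_iterate_def A_def B_def)
  show "mellin (euler_iterate G a \<epsilon> n (Suc j)) z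
       = z * mellin (euler_iterate G a \<epsilon> n j) z - euler_iterate G a \<epsilon> n j 1"
    unfolding diff A_def[symmetric] B_def[symmetric] at_1 recA recB by (simp add: algebra_simps)
qed

text \<open>
The entire function is the polynomial in \<open>z\<close> formed from the values of the iterates at \<open>x = 1\<close>,
as the recurrence for a single step shows. It must be entire, and not merely holomorphic near the
half-plane of convergence, because the left edge \<open>\<sigma>\<^sub>0\<close> of a given continuation is arbitrary.
\<close>

lemma mellin_euler_iterate_up_to_entire:
  assumes G: "vertically_rapid G" and a: "a > 1" and n: "n > 0"
  shows "\<exists>P. P holomorphic_on UNIV \<and> (\<forall>z. Re z > 0 \<longrightarrow>
           z ^ j * mellin (euler_iterate G a \<epsilon> n 0) z = mellin (euler_iterate G a \<epsilon> n j) z + P z)"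
proof (induction j)
  case 0
  show ?case by (rule exI[of _ "\<lambda>_. 0"]) auto
next
  case (Suc j)
  then obtain P where P: "P holomorphic_on UNIV"
    "\<And>z. Re z > 0 \<Longrightarrow> z ^ j * mellin (euler_iterate G a \<epsilon> n 0) z = mellin (euler_iterate G a \<epsilon> n j) z + P z"
    by blast
  show ?case
  proof (intro exI[of _ "\<lambda>z. z * P z + euler_iterate G a \<epsilon> n j 1"] conjI allI impI)
    fix z :: complex assume z: "Re z > 0"
    have "z ^ Suc j * mellin (euler_iterate G a \<epsilon> n 0) z = z * (mellin (euler_iterate G a \<epsilon> n j) z + P z)"
      using P(2)[OF z] by simp
    also have "\<dots> = mellin (euler_iterate G a \<epsilon> n (Suc j)) z + (z * P z + euler_iterate G a \<epsilon> n j 1)"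
      using mellin_integrable_euler_iterate(3)[OF G a n z, of \<epsilon> j] by (simp add: algebra_simps)
    finally show "z ^ Suc j * mellin (euler_iterate G a \<epsilon> n 0) z
        = mellin (euler_iterate G a \<epsilon> n (Suc j)) z + (z * P z + euler_iterate G a \<epsilon> n j 1)" .
  qed (intro holomorphic_intros P)
qed

text \<open>
On the line \<open>b'\<close> to the left of \<open>p = 1 + z/n\<close> the transform is the Cauchy integral
\<open>- 1/(2\<pi>n) \<integral> G(w)/(w - p) dt\<close>. Moving to the line \<open>a\<close> to the right of \<open>p\<close> picks up \<open>G(p)/n\<close>. The
remaining integral over the line \<open>a\<close> is itself a Mellin transform, at \<open>- z\<close> and for the opposite
exponent, and in this form it is visibly holomorphic around \<open>z = 0\<close>.
\<close>

lemma mellin_across_pole: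
  assumes G: "vertically_rapid G" and a: "a > 1" and n: "n > 0"
    and z: "Re z > 0" "Re z < real n * (a - 1)"
  shows "mellin (vertical_transform G (- real n) (real n) a) z
       = G (1 + z / of_nat n) / of_nat n - mellin (vertical_transform G (real n) (- real n) a) (- z)"
proof -
  note b = line_between_one_and_z[OF z(1) n]
  define b' where "b' = 1 + Re z / (2 * real n)"
  define p where "p = 1 + z / of_nat n"
  have nz: "(of_nat n :: complex) \<noteq> 0" "real n > 0" using n by auto
  have p: "b' < Re p" "Re p < a" "1 < b'"
    using n z by (auto simp: p_def b'_def field_simps)
  have ne: "Complex a t \<noteq> p" "Complex b' t \<noteq> p" for t using p by auto
  have dens: "G w / (z + (of_real (- real n) * w + of_real (real n))) = - (1 / of_nat n) * (G w / (w - p))" if "w \<noteq> p" for w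
  proof -
    have "z + (of_real (- real n) * w + of_real (real n)) = - of_nat n * (w - p)"
      using nz by (simp add: p_def field_simps)
    thus ?thesis by simp
  qed
  have dens': "G w / (- z + (of_real (real n) * w + of_real (- real n))) = 1 / of_nat n * (G w / (w - p))" if "w \<noteq> p" for w
  proof -
    have "- z + (of_real (real n) * w + of_real (- real n)) = of_nat n * (w - p)"
      using nz by (simp add: p_def field_simps)
    thus ?thesis by simp
  qed
  have "mellin (vertical_transform G (- real n) (real n) a) z
     = 1 / (2 * of_real pi) * (LINT t|lborel. - (1 / of_nat n) * (G (Complex b' t) / (Complex b' t - p)))"
    unfolding vertical_transform_mellin(2)[OF G a b] b'_def[symmetric] dens[OF ne(2)] ..
  also have "\<dots> = - (1 / of_nat n) * (1 / (2 * of_real pi)) * (LINT t|lborel. G (Complex b' t) / (Complex b' t - p))"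
    unfolding integral_mult_right_zero by (simp only: mult_ac)
  also have "(LINT t|lborel. G (Complex b' t) / (Complex b' t - p))
     = (LINT t|lborel. G (Complex a t) / (Complex a t - p)) - 2 * of_real pi * G p"
    using vertical_cauchy_formula[OF G p(3,1,2)] by (simp add: algebra_simps)
  also have "- (1 / of_nat n) * (1 / (2 * of_real pi)) * ((LINT t|lborel. G (Complex a t) / (Complex a t - p)) - 2 * of_real pi * G p)
     = G p / of_nat n - 1 / (2 * of_real pi) * (1 / of_nat n * (LINT t|lborel. G (Complex a t) / (Complex a t - p)))"
    using nz by (simp add: field_simps)
  also have "1 / (2 * of_real pi) * (1 / of_nat n * (LINT t|lborel. G (Complex a t) / (Complex a t - p)))
     = mellin (vertical_transform G (real n) (- real n) a) (- z)"
  proof -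
    have "Re (- z) + (real n * a + - real n) > 0" using z by (simp add: algebra_simps)
    from vertical_transform_mellin(2)[OF G a a this] show ?thesis
      unfolding dens'[OF ne(1)] integral_mult_right_zero by simp
  qed
  finally show ?thesis by (simp only: p_def)
qed

section \<open>The pole at the right edge\<close>

text \<open>
For \<open>\<bar>Im s\<bar> < 1\<close> the region of continuation contains \<open>Re s \<ge> 1 - \<eta>/ln 4\<close>.
\<close>

lemma dirichlet_holomorphic_near_1:
  assumes "cond_c2 c D lam_c"
  obtains \<rho> where "\<rho> > 0" "D holomorphic_on ball 1 \<rho> - {1}"
proof -
  from assms obtain \<eta> where \<eta>: "\<eta> > 0" "D analytic_on ({s. Re s \<ge> 1 - \<eta> / ln (3 + \<bar>Im s\<bar>)} - {1})"
    unfolding cond_c2_def by blast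
  define \<rho> where "\<rho> = min 1 (\<eta> / ln 4)"
  have l4: "ln (4::real) > 0" by simp
  have "ball 1 \<rho> - {1} \<subseteq> {s. Re s \<ge> 1 - \<eta> / ln (3 + \<bar>Im s\<bar>)} - {1}"
  proof
    fix s assume s: "s \<in> ball 1 \<rho> - {1::complex}"
    have "\<bar>Re (1 - s)\<bar> < \<rho>" "\<bar>Im (1 - s)\<bar> < \<rho>"
      using s abs_Re_le_cmod[of "1 - s"] abs_Im_le_cmod[of "1 - s"] by (auto simp: dist_norm)
    hence 1: "1 - Re s < \<eta> / ln 4" "\<bar>Im s\<bar> < 1" by (auto simp: \<rho>_def)
    have "ln (3 + \<bar>Im s\<bar>) \<le> ln 4" "ln (3 + \<bar>Im s\<bar>) > 0" using 1 by auto
    hence "\<eta> / ln 4 \<le> \<eta> / ln (3 + \<bar>Im s\<bar>)"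
      using \<eta> l4 by (intro divide_left_mono) auto
    thus "s \<in> {s. Re s \<ge> 1 - \<eta> / ln (3 + \<bar>Im s\<bar>)} - {1}" using 1 s by auto
  qed
  hence "D holomorphic_on ball 1 \<rho> - {1}"
    using \<eta>(2) by (meson analytic_imp_holomorphic analytic_on_subset)
  moreover have "\<rho> > 0" using \<eta> l4 by (simp add: \<rho>_def)
  ultimately show ?thesis using that by blast
qed

lemma pole_of_order_factor:
  assumes "has_pole_of_order f z k" "\<rho> > 0" "f holomorphic_on ball z \<rho> - {z}"
  obtains r g where "r > 0" "g holomorphic_on ball z r" "g z \<noteq> 0"
    "\<And>w. w \<in> ball z r \<Longrightarrow> w \<noteq> z \<Longrightarrow> (w - z) ^ k * f w = g w"
proof -
  have "is_pole f z" and k: "nat (- zorder f z) = k"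
    using assms(1) by (auto simp: has_pole_of_order_def)
  with zorder_exist_pole[OF assms(3) open_ball] \<open>\<rho> > 0\<close>
  obtain r where r: "r > 0" "zor_poly f z z \<noteq> 0" "zor_poly f z holomorphic_on cball z r"
    "\<And>w. w \<in> cball z r - {z} \<Longrightarrow> f w = zor_poly f z w / (w - z) ^ k"
    by (metis centre_in_ball k)
  show ?thesis
    by (rule that[of r "zor_poly f z"]) (use r in \<open>auto intro: holomorphic_on_subset\<close>)
qed

text \<open>
The orders of the two poles add up because the product of the two nonzero leading coefficients is
nonzero.
\<close>

lemma gamma_dirichlet_pole:
  assumes c2: "cond_c2 c D lam_c" and \<gamma>1: "cond_gamma1 \<gamma>" and \<gamma>2: "cond_gamma2 \<gamma> lam_\<gamma>"
  obtains r g where "r > 0" "g holomorphic_on ball 1 r" "g 1 \<noteq> 0"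
    "\<And>w. w \<in> ball 1 r \<Longrightarrow> w \<noteq> 1 \<Longrightarrow> (w - 1) ^ (lam_c + lam_\<gamma>) * (\<gamma> w * D w) = g w"
proof -
  obtain \<rho> where \<rho>: "\<rho> > 0" "D holomorphic_on ball 1 \<rho> - {1}"
    by (rule dirichlet_holomorphic_near_1[OF c2])
  have "has_pole_of_order D 1 lam_c" "has_pole_of_order \<gamma> 1 lam_\<gamma>"
    using c2 \<gamma>2 by (auto simp: cond_c2_def cond_gamma2_def)
  moreover have "\<gamma> holomorphic_on ball 1 1 - {1}"
    using \<gamma>1 unfolding cond_gamma1_def by (rule holomorphic_on_subset) auto
  ultimately obtain r1 g1 r2 g2 where
    1: "r1 > 0" "g1 holomorphic_on ball 1 r1" "g1 1 \<noteq> 0"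
      "\<And>w. w \<in> ball 1 r1 \<Longrightarrow> w \<noteq> 1 \<Longrightarrow> (w - 1) ^ lam_c * D w = g1 w" and
    2: "r2 > 0" "g2 holomorphic_on ball 1 r2" "g2 1 \<noteq> 0"
      "\<And>w. w \<in> ball 1 r2 \<Longrightarrow> w \<noteq> 1 \<Longrightarrow> (w - 1) ^ lam_\<gamma> * \<gamma> w = g2 w"
    using pole_of_order_factor[OF _ \<rho>] pole_of_order_factor[OF _ zero_less_one] by metis
  show ?thesis
  proof (rule that[of "min r1 r2" "\<lambda>w. g1 w * g2 w"])
    show "(\<lambda>w. g1 w * g2 w) holomorphic_on ball 1 (min r1 r2)"
      using 1(2) 2(2) by (intro holomorphic_intros) (auto intro: holomorphic_on_subset)
    show "(w - 1) ^ (lam_c + lam_\<gamma>) * (\<gamma> w * D w) = g1 w * g2 w"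
      if "w \<in> ball 1 (min r1 r2)" "w \<noteq> 1" for w
      using 1(4)[of w] 2(4)[of w] that by (simp add: power_add mult_ac flip: 1(4)[of w] 2(4)[of w])
  qed (use 1 2 in auto)
qed

lemma omega_fun_mellin:
  assumes h: "\<And>x. x > 0 \<Longrightarrow> h_fun c \<gamma> a \<epsilon> n x = f x"
  shows "omega_fun c \<gamma> a \<epsilon> n s = mellin f (s - of_nat n)"
proof -
  have "indicator {0<..<1} x *\<^sub>R (h_fun c \<gamma> a \<epsilon> n x * of_real x powr (s - of_nat n) / of_real x)
      = mellin_density f x * exp (of_real (ln x) * (s - of_nat n))" for x :: real
    using h[of x] by (cases "x > 0") (auto simp: mellin_density_def of_real_powr_exp mult.commute)
  thus ?thesis
    by (simp add: omega_fun_def mellin_def set_lebesgue_integral_def)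
qed

text \<open>
For \<open>Re z > 0\<close> near \<open>0\<close> the transform of \<open>h\<close> is a function that is regular at \<open>0\<close> minus
\<open>(\<epsilon>/n) G(1 + z/n)\<close>. Multiplication by \<open>z^k\<close> cancels the pole of \<open>G\<close>; at \<open>z = 0\<close> only the term
with \<open>G\<close> survives since \<open>k > 0\<close>, and it does not vanish.
\<close>

lemma mellin_euler_iterate_continuation_at_0:
  assumes G: "vertically_rapid G" and a: "a > 1" and n: "n > 0" and \<epsilon>: "\<epsilon> \<noteq> 0" and k: "k > 0"
    and g: "r > 0" "g holomorphic_on ball 1 r" "g 1 \<noteq> 0"
    and G_eq: "\<And>w. w \<in> ball 1 r \<Longrightarrow> w \<noteq> 1 \<Longrightarrow> (w - 1) ^ k * G w = g w"
  shows "\<exists>\<rho>>0. \<exists>N. N holomorphic_on ball 0 \<rho> \<and> N 0 \<noteq> 0 \<and>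
    (\<forall>z. z \<in> ball 0 \<rho> \<longrightarrow> Re z > 0 \<longrightarrow> z ^ k * mellin (euler_iterate G a \<epsilon> n 0) z = N z)"
proof -
  have n0: "(of_nat n :: complex) \<noteq> 0" "real n > 0" using n by auto
  let ?U = "mellin (vertical_transform G (real n) 0 a)"
  let ?W = "mellin (vertical_transform G (real n) (- real n) a)"
  \<comment> \<open>The three bounds keep \<open>1 + z/n\<close> in the disc of \<open>g\<close>, \<open>z\<close> in the domain of \<open>?U\<close>, and \<open>1 + z/n\<close> to the
    left of the line \<open>a\<close>.\<close>
  define \<rho> where "\<rho> = Min {real n * r, real n, real n * (a - 1)}"
  have \<rho>: "\<rho> > 0" "\<rho> \<le> real n * r" "\<rho> \<le> real n" "\<rho> \<le> real n * (a - 1)"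
    using g(1) n a by (auto simp: \<rho>_def)
  have Re_less: "\<bar>Re z\<bar> < \<rho>" if "z \<in> ball 0 \<rho>" for z :: complex
    using that abs_Re_le_cmod[of z] by (auto simp: dist_norm)
  have arg: "1 + z / of_nat n \<in> ball 1 r" if "z \<in> ball 0 \<rho>" for z :: complex
  proof -
    have "norm z < real n * r" using that \<rho> by (simp add: dist_norm)
    thus ?thesis using n0 by (simp add: dist_norm norm_divide field_simps)
  qed
  have U: "?U holomorphic_on {z. Re z > - (real n * a)}"
    by (rule mellin_holomorphic, rule vertical_transform_mellin(1)[OF G a a]) auto
  have W0: "?W holomorphic_on {z. Re z > - (real n * (a - 1))}"
    by (rule mellin_holomorphic, rule vertical_transform_mellin(1)[OF G a a]) (auto simp: algebra_simps)
  have W: "(\<lambda>z. ?W (- z)) holomorphic_on ball 0 \<rho>"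
  proof (rule holomorphic_on_compose_gen[OF _ W0, unfolded o_def])
    show "uminus holomorphic_on ball 0 \<rho>" by (rule holomorphic_on_minus[OF holomorphic_on_ident])
    show "uminus ` ball 0 \<rho> \<subseteq> {z. Re z > - (real n * (a - 1))}"
    proof safe
      fix z :: complex assume "z \<in> ball 0 \<rho>"
      from Re_less[OF this] \<rho>(4) show "- (real n * (a - 1)) < Re (- z)" by simp
    qed
  qed
  define N where "N z = z ^ k * ?U z - of_real \<epsilon> * (of_nat n ^ k * g (1 + z / of_nat n) / of_nat n - z ^ k * ?W (- z))" for z
  have "?U holomorphic_on ball 0 \<rho>"
  proof (rule holomorphic_on_subset[OF U], safe)
    fix z :: complex assume "z \<in> ball 0 \<rho>"
    from Re_less[OF this] \<rho>(3) have "Re z > - real n" by linarith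
    moreover have "real n * a > real n" using n a by simp
    ultimately show "- (real n * a) < Re z" by linarith
  qed
  moreover have "(\<lambda>z. g (1 + z / of_nat n)) holomorphic_on ball 0 \<rho>"
  proof (rule holomorphic_on_compose_gen[OF _ g(2), unfolded o_def])
    show "(\<lambda>z. 1 + z / of_nat n) holomorphic_on ball 0 \<rho>"
      using n0 by (intro holomorphic_intros) auto
    show "(\<lambda>z. 1 + z / of_nat n :: complex) ` ball 0 \<rho> \<subseteq> ball 1 r"
      using arg by blast
  qed
  ultimately have "N holomorphic_on ball 0 \<rho>"
    unfolding N_def[abs_def] using W n0 by (intro holomorphic_intros) auto
  moreover have "N 0 \<noteq> 0"
    using k g(3) n0 \<epsilon> by (simp add: N_def power_0_left)
  moreover have "z ^ k * mellin (euler_iterate G a \<epsilon> n 0) z = N z" if z: "z \<in> ball 0 \<rho>" "Re z > 0" for z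
  proof -
    have "Re z < real n * (a - 1)" using Re_less[OF z(1)] \<rho>(4) by linarith
    from mellin_across_pole[OF G a n z(2) this]
    have M: "mellin (euler_iterate G a \<epsilon> n 0) z = ?U z - of_real \<epsilon> * (G (1 + z / of_nat n) / of_nat n - ?W (- z))"
      using mellin_integrable_euler_iterate(2)[OF G a n z(2), of \<epsilon> 0] by simp
    have "1 + z / of_nat n \<noteq> 1" using z n0 by auto
    from G_eq[OF arg[OF z(1)] this]
    have "(z / of_nat n) ^ k * G (1 + z / of_nat n) = g (1 + z / of_nat n)" by simp
    hence "z ^ k * G (1 + z / of_nat n) = of_nat n ^ k * g (1 + z / of_nat n)"
      using n0 by (simp add: power_divide field_simps)
    thus ?thesis unfolding M N_def by (simp add: algebra_simps)
  qed
  ultimately show ?thesis using \<rho>(1) by blast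
qed

theorem theorem2:
  fixes c :: "nat \<Rightarrow> real" and D \<gamma> :: "complex \<Rightarrow> complex"
    and lam_c lam_\<gamma> n :: nat and a \<epsilon> x\<^sub>0 :: real
  assumes "cond_c1 c" and "cond_c2 c D lam_c" and "cond_c3 D"
    and "cond_gamma1 \<gamma>" and "cond_gamma2 \<gamma> lam_\<gamma>" and "cond_gamma3 \<gamma>"
    and "\<epsilon> \<in> {1, -1}" and "n > 0"
    and "a > 1"
    and "x\<^sub>0 > 0" and "single_sign_on (Z_fun c lam_c \<gamma> lam_\<gamma> a \<epsilon> n) {0<..<x\<^sub>0}"
  shows "(\<exists>\<delta>>0. \<exists>F.
            F holomorphic_on ({s. Re s > real n - \<delta>} - {of_nat n}) \<and>
            (\<forall>s. Re s > real n \<longrightarrow> F s = omega_fun c \<gamma> a \<epsilon> n s) \<and>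
            is_pole F (of_nat n)) \<and>
         (\<forall>\<sigma>\<^sub>0 F. \<sigma>\<^sub>0 < real n \<and>
            F meromorphic_on {s. Re s > \<sigma>\<^sub>0} \<and>
            (\<forall>s. Re s > real n \<longrightarrow> F s = omega_fun c \<gamma> a \<epsilon> n s) \<and>
            (\<forall>\<sigma>. \<sigma>\<^sub>0 < \<sigma> \<and> \<sigma> < real n \<longrightarrow> \<not> is_pole F (of_real \<sigma>)) \<longrightarrow>
            (\<forall>s. \<sigma>\<^sub>0 < Re s \<and> Re s < real n \<longrightarrow> \<not> is_pole F s))"
proof -
  let ?G = "\<lambda>s. \<gamma> s * D s"
  let ?E = "euler_iterate ?G a \<epsilon> n"
  let ?Z = "Z_fun c lam_c \<gamma> lam_\<gamma> a \<epsilon> n"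
  let ?\<omega> = "omega_fun c \<gamma> a \<epsilon> n"
  define k where "k = lam_c + lam_\<gamma>"
  have k: "k > 0" using assms(2) by (simp add: k_def cond_c2_def)
  have \<epsilon>: "\<epsilon> \<noteq> 0" using assms(7) by auto
  have \<gamma>: "vertically_rapid \<gamma>" by (rule vertically_rapid_gamma[OF assms(4,6)])
  have G: "vertically_rapid ?G"
    by (rule vertically_rapid_mult_moderate[OF \<gamma> vertically_moderate_dirichlet[OF assms(1,2)]])
  have h: "h_fun c \<gamma> a \<epsilon> n x = ?E 0 x" if "x > 0" for x
    using h_fun_vertical_transform[OF assms(1,2) \<gamma> assms(9) that, of \<epsilon> n] by (simp add: euler_iterate_def)
  have Z: "?Z x = ?E k x" if "x > 0" for x
    unfolding Z_fun_def k_def using G assms(9) h that by (rule neg_euler_op_power_euler_iterate)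
  have mZ: "mellin ?Z = mellin (?E k)" "mellin_integrable ?Z = mellin_integrable (?E k)"
    by (rule mellin_cong, rule Z, assumption)+
  have \<omega>: "?\<omega> s = mellin (?E 0) (s - of_nat n)" for s
    by (rule omega_fun_mellin[OF h])
  obtain P where P: "P holomorphic_on UNIV"
    "\<And>z. Re z > 0 \<Longrightarrow> z ^ k * mellin (?E 0) z = mellin (?E k) z + P z"
    using mellin_euler_iterate_up_to_entire[OF G assms(9,8)] by blast
  obtain r g where g: "r > 0" "g holomorphic_on ball 1 r" "g 1 \<noteq> 0"
    "\<And>w. w \<in> ball 1 r \<Longrightarrow> w \<noteq> 1 \<Longrightarrow> (w - 1) ^ k * ?G w = g w"
    unfolding k_def by (rule gamma_dirichlet_pole[OF assms(2,4,5)]) blast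
  obtain \<rho> N where N: "\<rho> > 0" "N holomorphic_on ball 0 \<rho>" "N 0 \<noteq> 0"
    "\<And>z. z \<in> ball 0 \<rho> \<Longrightarrow> Re z > 0 \<Longrightarrow> z ^ k * mellin (?E 0) z = N z"
    using mellin_euler_iterate_continuation_at_0[OF G assms(9,8) \<epsilon> k g] by blast
  have conv: "mellin_integrable ?Z (of_real \<sigma>)" if "\<sigma> > 0" for \<sigma>
    unfolding mZ by (rule mellin_integrable_euler_iterate(1)[OF G assms(9,8)]) (use that in simp)
  have P_hol: "(\<lambda>s. P (s - of_nat n)) holomorphic_on UNIV"
    by (rule holomorphic_on_compose_gen[OF _ P(1), unfolded o_def]) (auto intro!: holomorphic_intros)
  have N_hol: "(\<lambda>s. N (s - of_nat n)) holomorphic_on ball (of_real (real n)) \<rho>"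
    by (rule holomorphic_on_compose_gen[OF _ N(2), unfolded o_def])
       (auto simp: dist_norm norm_minus_commute intro!: holomorphic_intros)
  have N_nz: "N (of_real (real n) - of_nat n) \<noteq> 0" using N(3) by simp
  have \<omega>_eq: "(s - of_real (real n)) ^ k * ?\<omega> s = mellin ?Z (s - of_real (real n)) + P (s - of_nat n)"
    if "Re s > real n" for s
    using P(2)[of "s - of_nat n"] that by (simp add: \<omega> mZ)
  have N_eq: "(s - of_real (real n)) ^ k * ?\<omega> s = N (s - of_nat n)"
    if "s \<in> ball (of_real (real n)) \<rho>" "Re s > real n" for s
    using N(4)[of "s - of_nat n"] that by (simp add: \<omega> dist_norm norm_minus_commute)
  note Landau = Landau_continuation[OF assms(10,11) conv P_hol \<omega>_eq N(1) N_hol N_nz N_eq k]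
  show ?thesis
    using Landau(1) Landau(2) by (simp only: of_real_of_nat_eq) blast
qed

end
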